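(* Let $M\in\mathcal{O}^{\mathfrak{p}}$. If $M$ has a finite-dimensional quotient $V$ (as a $\mathfrak{g}$-module), then $\operatorname{Res}_{\mathfrak{p}}^{\mathfrak{g}}V$ is a direct summand of $\operatorname{Res}_{\mathfrak{p}}^{\mathfrak{g}}M$ (as a $\mathfrak{p}$-module).
   Context: $\mathfrak{g}$ is a finite-dimensional complex semisimple Lie algebra with Cartan decomposition $\mathfrak{g}=\mathfrak{n}^-\oplus\mathfrak{h}\oplus\mathfrak{n}$, $\mathfrak{b}=\mathfrak{h}\oplus\mathfrak{n}$, and $\mathfrak{p}=\mathfrak{p}_I\supset\mathfrak{b}$ is the standard parabolic subalgebra attached to a subset $I$ of the simple roots. $\mathcal{O}$ is the BGG category and $\mathcal{O}^{\mathfrak{p}}$ the parabolic subcategory (modules in $\mathcal{O}$ that are locally $\mathfrak{p}$-finite). $\operatorname{Res}_{\mathfrak{p}}^{\mathfrak{g}}$ is restriction from $\mathfrak{g}$-modules to $\mathfrak{p}$-modules. *)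

theory Defs
  imports Complex_Main "HOL-Library.Function_Algebras"
begin

section \<open>Lie algebras over the complex numbers\<close>

definition finite_dim :: "(complex \<Rightarrow> 'a::ab_group_add \<Rightarrow> 'a) \<Rightarrow> 'a set \<Rightarrow> bool"
  where "finite_dim scale W \<longleftrightarrow> (\<exists>B. finite B \<and> module.span scale B = W)"

locale lie_algebra = vector_space scale
  for scale :: "complex \<Rightarrow> 'g::ab_group_add \<Rightarrow> 'g" +
  fixes bracket :: "'g \<Rightarrow> 'g \<Rightarrow> 'g"
  assumes bracket_add_left: "bracket (x + y) z = bracket x z + bracket y z"
    and bracket_add_right: "bracket x (y + z) = bracket x y + bracket x z"
    and bracket_scale_left: "bracket (scale c x) y = scale c (bracket x y)"
    and bracket_scale_right: "bracket x (scale c y) = scale c (bracket x y)"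
    and bracket_self: "bracket x x = 0"
    and jacobi: "bracket x (bracket y z) + bracket y (bracket z x) + bracket z (bracket x y) = 0"
begin

definition subalgebra :: "'g set \<Rightarrow> bool"
  where "subalgebra A \<longleftrightarrow> subspace A \<and> (\<forall>x\<in>A. \<forall>y\<in>A. bracket x y \<in> A)"

definition lie_ideal :: "'g set \<Rightarrow> bool"
  where "lie_ideal A \<longleftrightarrow> subspace A \<and> (\<forall>x. \<forall>y\<in>A. bracket x y \<in> A)"

definition derived :: "'g set \<Rightarrow> 'g set"
  where "derived A = span {bracket x y |x y. x \<in> A \<and> y \<in> A}"

definition solvable :: "'g set \<Rightarrow> bool"
  where "solvable A \<longleftrightarrow> (\<exists>n. (derived ^^ n) A = {0})"

definition semisimple :: bool
  where "semisimple \<longleftrightarrow> (\<forall>A. lie_ideal A \<and> solvable A \<longrightarrow> A = {0})"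

definition ad_diagonalizable :: "'g \<Rightarrow> bool"
  where "ad_diagonalizable x \<longleftrightarrow> span {y. \<exists>c. bracket x y = scale c y} = UNIV"

definition toral :: "'g set \<Rightarrow> bool"
  where "toral A \<longleftrightarrow> subalgebra A \<and> (\<forall>x\<in>A. \<forall>y\<in>A. bracket x y = 0) \<and>
    (\<forall>x\<in>A. ad_diagonalizable x)"

definition centralizer :: "'g set \<Rightarrow> 'g set"
  where "centralizer A = {x. \<forall>a\<in>A. bracket a x = 0}"

text \<open>Cartan subalgebras are used only in semisimple Lie algebras, where they are the toral
  subalgebras that coincide with their centralizer.\<close>

definition cartan_subalgebra :: "'g set \<Rightarrow> bool"
  where "cartan_subalgebra H \<longleftrightarrow> toral H \<and> centralizer H = H"

end


section \<open>Modules\<close>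

text \<open>The argument \<open>L\<close> is the Lie subalgebra that acts, and only the values \<open>act x\<close> with
  \<open>x \<in> L\<close> are relevant. The restriction of a module over the full Lie algebra
  (\<open>L = UNIV\<close>) to a subalgebra therefore has the same \<open>scaleM\<close> and \<open>act\<close>, with a smaller
  \<open>L\<close>.\<close>

locale lie_module = lie_algebra scale bracket + M: vector_space scaleM
  for scale :: "complex \<Rightarrow> 'g::ab_group_add \<Rightarrow> 'g"
    and bracket :: "'g \<Rightarrow> 'g \<Rightarrow> 'g"
    and L :: "'g set"
    and scaleM :: "complex \<Rightarrow> 'm::ab_group_add \<Rightarrow> 'm"
    and act :: "'g \<Rightarrow> 'm \<Rightarrow> 'm" +
  assumes subalgebra_acting: "subalgebra L"
    and act_add_left: "x \<in> L \<Longrightarrow> y \<in> L \<Longrightarrow> act (x + y) v = act x v + act y v"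
    and act_scale_left: "x \<in> L \<Longrightarrow> act (scale c x) v = scaleM c (act x v)"
    and act_add_right: "x \<in> L \<Longrightarrow> act x (v + w) = act x v + act x w"
    and act_scale_right: "x \<in> L \<Longrightarrow> act x (scaleM c v) = scaleM c (act x v)"
    and act_bracket: "x \<in> L \<Longrightarrow> y \<in> L \<Longrightarrow>
      act (bracket x y) v = act x (act y v) - act y (act x v)"

lemma lie_module_restrict:
  assumes "lie_module scale bracket L scaleM act"
    and "lie_algebra.subalgebra scale bracket K" "K \<subseteq> L"
  shows "lie_module scale bracket K scaleM act"
proof -
  interpret lie_module scale bracket L scaleM act by (fact assms(1))
  show ?thesis
    using assms(2,3)
    by unfold_locales
      (auto simp: subset_iff act_add_left act_scale_left act_add_right act_scale_right act_bracket)
qed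

definition lie_submodule ::
    "'g set \<Rightarrow> (complex \<Rightarrow> 'm::ab_group_add \<Rightarrow> 'm) \<Rightarrow> ('g \<Rightarrow> 'm \<Rightarrow> 'm) \<Rightarrow> 'm set \<Rightarrow> bool"
  where "lie_submodule L scaleM act W \<longleftrightarrow>
    module.subspace scaleM W \<and> (\<forall>x\<in>L. \<forall>w\<in>W. act x w \<in> W)"

text \<open>For a subalgebra \<open>L\<close> this is the submodule generated over the universal enveloping
  algebra \<open>U(L)\<close>, since \<open>L\<close>-submodules and \<open>U(L)\<close>-submodules are the same.\<close>

definition generated_submodule ::
    "'g set \<Rightarrow> (complex \<Rightarrow> 'm::ab_group_add \<Rightarrow> 'm) \<Rightarrow> ('g \<Rightarrow> 'm \<Rightarrow> 'm) \<Rightarrow> 'm set \<Rightarrow> 'm set"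
  where "generated_submodule L scaleM act S = \<Inter>{W. lie_submodule L scaleM act W \<and> S \<subseteq> W}"

definition finitely_generated ::
    "'g set \<Rightarrow> (complex \<Rightarrow> 'm::ab_group_add \<Rightarrow> 'm) \<Rightarrow> ('g \<Rightarrow> 'm \<Rightarrow> 'm) \<Rightarrow> bool"
  where "finitely_generated L scaleM act \<longleftrightarrow>
    (\<exists>S. finite S \<and> generated_submodule L scaleM act S = UNIV)"

definition locally_finite ::
    "'g set \<Rightarrow> (complex \<Rightarrow> 'm::ab_group_add \<Rightarrow> 'm) \<Rightarrow> ('g \<Rightarrow> 'm \<Rightarrow> 'm) \<Rightarrow> bool"
  where "locally_finite L scaleM act \<longleftrightarrow>
    (\<forall>v. finite_dim scaleM (generated_submodule L scaleM act {v}))"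

definition lie_hom ::
    "'g set \<Rightarrow> (complex \<Rightarrow> 'm::ab_group_add \<Rightarrow> 'm) \<Rightarrow> ('g \<Rightarrow> 'm \<Rightarrow> 'm) \<Rightarrow>
      (complex \<Rightarrow> 'n::ab_group_add \<Rightarrow> 'n) \<Rightarrow> ('g \<Rightarrow> 'n \<Rightarrow> 'n) \<Rightarrow> ('m \<Rightarrow> 'n) \<Rightarrow> bool"
  where "lie_hom L scaleM actM scaleN actN f \<longleftrightarrow>
    Vector_Spaces.linear scaleM scaleN f \<and> (\<forall>x\<in>L. \<forall>v. f (actM x v) = actN x (f v))"

definition lie_quotient ::
    "'g set \<Rightarrow> (complex \<Rightarrow> 'v::ab_group_add \<Rightarrow> 'v) \<Rightarrow> ('g \<Rightarrow> 'v \<Rightarrow> 'v) \<Rightarrow>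
      (complex \<Rightarrow> 'm::ab_group_add \<Rightarrow> 'm) \<Rightarrow> ('g \<Rightarrow> 'm \<Rightarrow> 'm) \<Rightarrow> bool"
  where "lie_quotient L scaleV actV scaleM actM \<longleftrightarrow>
    (\<exists>f. lie_hom L scaleM actM scaleV actV f \<and> surj f)"

definition lie_direct_summand ::
    "'g set \<Rightarrow> (complex \<Rightarrow> 'v::ab_group_add \<Rightarrow> 'v) \<Rightarrow> ('g \<Rightarrow> 'v \<Rightarrow> 'v) \<Rightarrow>
      (complex \<Rightarrow> 'm::ab_group_add \<Rightarrow> 'm) \<Rightarrow> ('g \<Rightarrow> 'm \<Rightarrow> 'm) \<Rightarrow> bool"
  where "lie_direct_summand L scaleV actV scaleM actM \<longleftrightarrow>
    (\<exists>A B. lie_submodule L scaleM actM A \<and> lie_submodule L scaleM actM B \<and>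
      A \<inter> B = {0} \<and> {a + b |a b. a \<in> A \<and> b \<in> B} = UNIV \<and>
      (\<exists>f. lie_hom L scaleV actV scaleM actM f \<and> bij_betw f UNIV A))"


section \<open>Roots, parabolic subalgebras and category \<open>\<O>\<close>\<close>

definition weight_space ::
    "'g set \<Rightarrow> (complex \<Rightarrow> 'm::ab_group_add \<Rightarrow> 'm) \<Rightarrow> ('g \<Rightarrow> 'm \<Rightarrow> 'm) \<Rightarrow> ('g \<Rightarrow> complex) \<Rightarrow> 'm set"
  where "weight_space H scaleM act \<mu> = {v. \<forall>x\<in>H. act x v = scaleM (\<mu> x) v}"

definition nat_combinations :: "('g \<Rightarrow> complex) set \<Rightarrow> ('g \<Rightarrow> complex) set"
  where "nat_combinations S =
    {\<beta>. \<exists>c::('g \<Rightarrow> complex) \<Rightarrow> nat. \<beta> = (\<lambda>x. \<Sum>\<alpha>\<in>S. of_nat (c \<alpha>) * \<alpha> x)}"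

definition int_combinations :: "('g \<Rightarrow> complex) set \<Rightarrow> ('g \<Rightarrow> complex) set"
  where "int_combinations S =
    {\<beta>. \<exists>c::('g \<Rightarrow> complex) \<Rightarrow> int. \<beta> = (\<lambda>x. \<Sum>\<alpha>\<in>S. of_int (c \<alpha>) * \<alpha> x)}"

context lie_algebra
begin

text \<open>A functional on \<open>H\<close> is represented by its extension by zero to the whole type, so that
  equality and pointwise operations of the functions are those of the dual space of \<open>H\<close>.\<close>

definition dual_space :: "'g set \<Rightarrow> ('g \<Rightarrow> complex) set"
  where "dual_space H = {\<mu>. (\<forall>x\<in>H. \<forall>y\<in>H. \<mu> (x + y) = \<mu> x + \<mu> y) \<and>
    (\<forall>c. \<forall>x\<in>H. \<mu> (scale c x) = c * \<mu> x) \<and> (\<forall>x. x \<notin> H \<longrightarrow> \<mu> x = 0)}"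

definition root_space :: "'g set \<Rightarrow> ('g \<Rightarrow> complex) \<Rightarrow> 'g set"
  where "root_space H \<alpha> = weight_space H scale bracket \<alpha>"

definition roots :: "'g set \<Rightarrow> ('g \<Rightarrow> complex) set"
  where "roots H = {\<alpha> \<in> dual_space H. \<alpha> \<noteq> 0 \<and> root_space H \<alpha> \<noteq> {0}}"

text \<open>The simple roots form a basis of the real span of all roots; that they span is implied by
  the last condition.\<close>

definition root_base :: "'g set \<Rightarrow> ('g \<Rightarrow> complex) set \<Rightarrow> bool"
  where "root_base H \<Delta> \<longleftrightarrow> finite \<Delta> \<and> \<Delta> \<subseteq> roots H \<and>
    \<not> module.dependent (\<lambda>(r::real) f x. of_real r * f x) \<Delta> \<and>
    (\<forall>\<beta>\<in>roots H. \<beta> \<in> nat_combinations \<Delta> \<or> - \<beta> \<in> nat_combinations \<Delta>)"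

definition positive_roots :: "'g set \<Rightarrow> ('g \<Rightarrow> complex) set \<Rightarrow> ('g \<Rightarrow> complex) set"
  where "positive_roots H \<Delta> = roots H \<inter> nat_combinations \<Delta>"

definition positive_part :: "'g set \<Rightarrow> ('g \<Rightarrow> complex) set \<Rightarrow> 'g set"
  where "positive_part H \<Delta> = span (\<Union>\<alpha>\<in>positive_roots H \<Delta>. root_space H \<alpha>)"

definition levi_roots :: "'g set \<Rightarrow> ('g \<Rightarrow> complex) set \<Rightarrow> ('g \<Rightarrow> complex) set"
  where "levi_roots H I = roots H \<inter> int_combinations I"

definition levi_subalgebra :: "'g set \<Rightarrow> ('g \<Rightarrow> complex) set \<Rightarrow> 'g set"
  where "levi_subalgebra H I = span (H \<union> (\<Union>\<alpha>\<in>levi_roots H I. root_space H \<alpha>))"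

definition parabolic_nilradical ::
    "'g set \<Rightarrow> ('g \<Rightarrow> complex) set \<Rightarrow> ('g \<Rightarrow> complex) set \<Rightarrow> 'g set"
  where "parabolic_nilradical H \<Delta> I =
    span (\<Union>\<alpha>\<in>positive_roots H \<Delta> - levi_roots H I. root_space H \<alpha>)"

definition standard_parabolic ::
    "'g set \<Rightarrow> ('g \<Rightarrow> complex) set \<Rightarrow> ('g \<Rightarrow> complex) set \<Rightarrow> 'g set"
  where "standard_parabolic H \<Delta> I =
    {x + y |x y. x \<in> levi_subalgebra H I \<and> y \<in> parabolic_nilradical H \<Delta> I}"

text \<open>The sum of the weight spaces is automatically direct.\<close>

definition weight_module ::
    "'g set \<Rightarrow> (complex \<Rightarrow> 'm::ab_group_add \<Rightarrow> 'm) \<Rightarrow> ('g \<Rightarrow> 'm \<Rightarrow> 'm) \<Rightarrow> bool"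
  where "weight_module H scaleM act \<longleftrightarrow>
    module.span scaleM (\<Union>\<mu>\<in>dual_space H. weight_space H scaleM act \<mu>) = UNIV"

definition category_O ::
    "'g set \<Rightarrow> ('g \<Rightarrow> complex) set \<Rightarrow>
      (complex \<Rightarrow> 'm::ab_group_add \<Rightarrow> 'm) \<Rightarrow> ('g \<Rightarrow> 'm \<Rightarrow> 'm) \<Rightarrow> bool"
  where "category_O H \<Delta> scaleM act \<longleftrightarrow>
    lie_module scale bracket UNIV scaleM act \<and>
    finitely_generated UNIV scaleM act \<and>
    weight_module H scaleM act \<and>
    locally_finite (positive_part H \<Delta>) scaleM act"

definition parabolic_category_O ::
    "'g set \<Rightarrow> ('g \<Rightarrow> complex) set \<Rightarrow> ('g \<Rightarrow> complex) set \<Rightarrow>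
      (complex \<Rightarrow> 'm::ab_group_add \<Rightarrow> 'm) \<Rightarrow> ('g \<Rightarrow> 'm \<Rightarrow> 'm) \<Rightarrow> bool"
  where "parabolic_category_O H \<Delta> I scaleM act \<longleftrightarrow>
    category_O H \<Delta> scaleM act \<and>
    locally_finite (standard_parabolic H \<Delta> I) scaleM act"

end

end

theory Submission
  imports Defs
begin

text \<open>Let \<open>f\<close> be the projection of \<open>M\<close> to \<open>V\<close>. The Lie algebra acts on \<open>Hom(V, M)\<close>, and a
  \<open>\<pp>\<close>-equivariant section of \<open>f\<close> is an element \<open>\<psi>\<close> of \<open>Hom(V, M)\<close> that is annihilated by \<open>\<pp>\<close>
  and satisfies \<open>f \<circ> \<psi> = id\<close>. Since \<open>M\<close> and \<open>V\<close> are weight modules, there is an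
  \<open>\<hh>\<close>-equivariant section \<open>\<phi>\<close> (\<open>weight_equivariant_section\<close>), that is, one of weight zero. It is
  corrected by a polynomial in the Casimir operator \<open>\<Omega>\<close> of \<open>Hom(V, M)\<close>.

  On a vector of weight \<open>\<nu>\<close>, \<open>\<Omega>\<close> is the scalar \<open>c\<^sub>\<nu> = (\<nu>, \<nu> + 2\<rho>)\<close> plus a sum of products of two
  root vectors whose first applied factor lies in \<open>\<nn>\<close> (\<open>casimir_on_weight_space\<close>). Here
  \<open>c\<^sub>0 = 0\<close>, and \<open>c\<^sub>\<nu>\<close> is nonzero for all other nonnegative combinations \<open>\<nu>\<close> of simple roots
  (\<open>casimir_scalar_nonzero\<close>). As \<open>\<nn>\<close> acts nilpotently on \<open>\<phi>\<close> (\<open>hom_nilpotent\<close>), a product \<open>p(\<Omega>)\<close> of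
  factors \<open>\<Omega> - c\<close> with \<open>c \<noteq> 0\<close> maps \<open>\<phi>\<close> to a vector \<open>\<psi>\<close> of weight zero that is annihilated by \<open>\<nn>\<close>
  (\<open>casimir_projection\<close>). Composition with \<open>f\<close> maps \<open>Hom(V, M)\<close> to \<open>Hom(V, V)\<close>, where \<open>\<Omega>\<close> kills the
  identity, so that \<open>f \<circ> \<psi>\<close> is still the nonzero multiple \<open>p(0)\<close> of the identity. Finally, \<open>M\<close> is
  locally \<open>\<pp>\<close>-finite, so that a root vector of a negative root of the Levi factor acts nilpotently
  on \<open>\<psi>\<close>. By the commutation relations of \<open>sl\<^sub>2\<close> it annihilates \<open>\<psi>\<close>
  (\<open>opposite_vector_annihilates\<close>).

  The structure of the semisimple Lie algebra enters through an invariant nondegenerate form. The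
  basic tool is that a commutator has trace zero. Along root strings this shows that a nonzero
  bracket of opposite root vectors is not isotropic for the Killing form
  (\<open>commutator_anisotropic\<close>). The root vectors in the radical of the form therefore span an ideal,
  which acts nilpotently by a theorem of Engel and Jacobson (\<open>weakly_closed_nilpotent\<close>) and thus
  vanishes (\<open>killing_nondegenerate\<close>). The form is positive definite on real combinations of roots,
  and one more trace shows that \<open>(\<rho>, \<alpha>) \<ge> 0\<close> for simple \<open>\<alpha>\<close> (\<open>negative_trace_simple\<close>).\<close>

section \<open>Joint eigenvectors and traces\<close>

context vector_space
begin

text \<open>For two distinct families \<open>\<mu>\<close>, \<open>\<nu>\<close> of eigenvalues some operator separates them, and
  subtracting \<open>\<nu> i\<close> from this operator \<open>T i\<close> removes \<open>v \<nu>\<close> from a vanishing sum.\<close>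

lemma joint_eigenvectors_independent:
  assumes "finite F"
    and "\<And>i x y. i \<in> I \<Longrightarrow> T i (x + y) = T i x + T i y"
    and "\<And>i c x. i \<in> I \<Longrightarrow> T i (scale c x) = scale c (T i x)"
    and "\<And>\<mu> i. \<mu> \<in> F \<Longrightarrow> i \<in> I \<Longrightarrow> T i (v \<mu>) = scale (\<mu> i) (v \<mu>)"
    and "\<And>\<mu> \<nu>. \<mu> \<in> F \<Longrightarrow> \<nu> \<in> F \<Longrightarrow> (\<And>i. i \<in> I \<Longrightarrow> \<mu> i = \<nu> i) \<Longrightarrow> \<mu> = \<nu>"
    and "(\<Sum>\<mu>\<in>F. v \<mu>) = 0" and "\<mu> \<in> F"
  shows "v \<mu> = 0"
  using assms(1,4-)
proof (induction F arbitrary: v \<mu> rule: finite_induct)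
  case empty
  then show ?case by simp
next
  case (insert \<nu> F)
  have T_sum: "T i (sum f A) = (\<Sum>a\<in>A. T i (f a))" if "i \<in> I" for i f and A :: "('c \<Rightarrow> 'a) set"
  proof -
    have "T i 0 = 0" using assms(3)[OF that, of 0 0] by simp
    then show ?thesis
      by (induction A rule: infinite_finite_induct) (auto simp: assms(2)[OF that])
  qed
  have zero: "v \<kappa> = 0" if "\<kappa> \<in> F" for \<kappa>
  proof -
    have "\<kappa> \<noteq> \<nu>" using insert that by auto
    moreover have "\<kappa> = \<nu>" if "\<And>i. i \<in> I \<Longrightarrow> \<kappa> i = \<nu> i"
      using insert.prems(2)[of \<kappa> \<nu>] that \<open>\<kappa> \<in> F\<close> by simp
    ultimately obtain i where i: "i \<in> I" "\<kappa> i \<noteq> \<nu> i"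
      by auto
    have v\<nu>: "v \<nu> = - (\<Sum>\<mu>\<in>F. v \<mu>)"
      using insert.hyps insert.prems(3) by (simp add: eq_neg_iff_add_eq_0)
    have "(\<Sum>\<mu>\<in>insert \<nu> F. T i (v \<mu>)) = 0"
      using T_sum[OF i(1), of v "insert \<nu> F"] insert.prems(3) assms(3)[OF i(1), of 0 0] by simp
    then have "(\<Sum>\<mu>\<in>F. scale (\<mu> i) (v \<mu>)) + scale (\<nu> i) (v \<nu>) = 0"
      using insert.hyps insert.prems(1) i by (simp add: add.commute)
    then have "(\<Sum>\<mu>\<in>F. scale (\<mu> i - \<nu> i) (v \<mu>)) = 0"
      unfolding v\<nu> by (simp add: scale_left_diff_distrib sum_subtractf scale_sum_right)
    moreover have "T k (scale (\<mu> i - \<nu> i) (v \<mu>)) = scale (\<mu> k) (scale (\<mu> i - \<nu> i) (v \<mu>))"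
      if "\<mu> \<in> F" "k \<in> I" for \<mu> k
      using insert.prems(1) that by (simp add: assms(3) mult.commute)
    ultimately have "scale (\<kappa> i - \<nu> i) (v \<kappa>) = 0"
      using insert.IH[of "\<lambda>\<mu>. scale (\<mu> i - \<nu> i) (v \<mu>)" \<kappa>] insert.prems(2) \<open>\<kappa> \<in> F\<close> by auto
    then show ?thesis using i by simp
  qed
  then have "(\<Sum>\<mu>\<in>F. v \<mu>) = 0" by simp
  then have "v \<nu> = 0" using insert.hyps insert.prems(3) by simp
  then show ?case using zero insert.prems by auto
qed

lemma span_Union_subspaces_sum:
  assumes "\<And>a. a \<in> A \<Longrightarrow> subspace (E a)" and "y \<in> span (\<Union>a\<in>A. E a)"
  shows "\<exists>F w. finite F \<and> F \<subseteq> A \<and> (\<forall>a\<in>F. w a \<in> E a) \<and> y = (\<Sum>a\<in>F. w a)"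
  using assms(2)
proof (induction rule: span_induct_alt)
  case base
  show ?case by (rule exI[of _ "{}"]) auto
next
  case (step c x y)
  then obtain F w a where F: "finite F" "F \<subseteq> A" "\<forall>a\<in>F. w a \<in> E a" "y = (\<Sum>a\<in>F. w a)"
    and a: "a \<in> A" "x \<in> E a" by blast
  define w' where "w' = w(a := scale c x + (if a \<in> F then w a else 0))"
  have "w' b \<in> E b" if "b \<in> insert a F" for b
    using that F a assms(1)
    by (auto simp: w'_def intro!: subspace_add subspace_scale subspace_0)
  moreover have "(\<Sum>b\<in>insert a F. w' b) = w' a + (\<Sum>b\<in>F - {a}. w b)"
    using F by (subst sum.insert_remove) (auto simp: w'_def intro!: sum.cong)
  moreover have "y = (if a \<in> F then w a else 0) + (\<Sum>b\<in>F - {a}. w b)"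
    using F by (auto simp: sum.remove)
  ultimately have "scale c x + y = (\<Sum>b\<in>insert a F. w' b)"
    by (simp add: w'_def add.assoc)
  then show ?case using F a \<open>\<And>b. b \<in> insert a F \<Longrightarrow> w' b \<in> E b\<close>
    by (intro exI[of _ "insert a F"] exI[of _ w']) auto
qed

text \<open>The eigenvectors of the new operator into which a joint eigenvector of the old operators
  decomposes are again joint eigenvectors of the old ones, because these commute with the new one
  and the decomposition into eigenvectors for distinct eigenvalues is unique.\<close>

lemma simultaneously_diagonalizable:
  assumes "finite I"
    and "\<And>i x y. i \<in> I \<Longrightarrow> T i (x + y) = T i x + T i y"
    and "\<And>i c x. i \<in> I \<Longrightarrow> T i (scale c x) = scale c (T i x)"
    and "\<And>i j x. i \<in> I \<Longrightarrow> j \<in> I \<Longrightarrow> T i (T j x) = T j (T i x)"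
    and "\<And>i. i \<in> I \<Longrightarrow> span {y. \<exists>c. T i y = scale c y} = UNIV"
  shows "span {y. \<forall>i\<in>I. \<exists>c. T i y = scale c y} = UNIV"
  using assms
proof (induction I rule: finite_induct)
  case empty
  then show ?case by simp
next
  case (insert j I)
  let ?S = "{y. \<forall>i\<in>insert j I. \<exists>c. T i y = scale c y}"
  have "y \<in> span ?S" if y: "\<forall>i\<in>I. \<exists>c. T i y = scale c y" for y
  proof -
    define E where "E c = {y. T j y = scale c y}" for c
    have "subspace (E c)" for c
      unfolding subspace_def E_def
      using insert.prems(1,2)[of j] insert.prems(2)[of j 0 0]
      by (auto simp: scale_right_distrib mult.commute)
    moreover have "y \<in> span (\<Union>c\<in>UNIV. E c)"
    proof -
      have "(\<Union>c\<in>UNIV. E c) = {y. \<exists>c. T j y = scale c y}" by (auto simp: E_def)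
      then show ?thesis using insert.prems(4)[of j] by simp
    qed
    ultimately have "\<exists>F w. finite F \<and> F \<subseteq> UNIV \<and> (\<forall>c\<in>F. w c \<in> E c) \<and> y = (\<Sum>c\<in>F. w c)"
      by (intro span_Union_subspaces_sum) auto
    then obtain F w where F: "finite F" "F \<subseteq> UNIV" "\<forall>c\<in>F. w c \<in> E c" "y = (\<Sum>c\<in>F. w c)"
      by blast
    have "w c \<in> ?S" if "c \<in> F" for c
    proof -
      have "\<exists>d. T i (w c) = scale d (w c)" if "i \<in> I" for i
      proof -
        obtain d where d: "T i y = scale d y" using y \<open>i \<in> I\<close> by blast
        have add_i: "T i (a + b) = T i a + T i b" for a b
          using insert.prems(1) \<open>i \<in> I\<close> by simp
        have "T i 0 = 0" using insert.prems(2)[of i 0 0] \<open>i \<in> I\<close> by simp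
        then have T_sum: "T i (sum w A) = (\<Sum>a\<in>A. T i (w a))" for A
          by (induction A rule: infinite_finite_induct) (auto simp: add_i)
        define v where "v \<mu> = T i (w (\<mu> ())) - scale d (w (\<mu> ()))" for \<mu> :: "unit \<Rightarrow> 'a"
        let ?F = "(\<lambda>c _. c) ` F :: (unit \<Rightarrow> 'a) set"
        have inj: "inj_on (\<lambda>c (_::unit). c) F" by (auto simp: inj_on_def fun_eq_iff)
        have "(\<Sum>\<mu>\<in>?F. v \<mu>) = (\<Sum>c\<in>F. T i (w c) - scale d (w c))"
          by (subst sum.reindex[OF inj]) (simp add: v_def)
        also have "\<dots> = T i y - scale d y"
          by (simp add: F(4) T_sum sum_subtractf scale_sum_right)
        finally have "(\<Sum>\<mu>\<in>?F. v \<mu>) = 0" using d by simp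
        moreover have "T j (v \<mu>) = scale (\<mu> ()) (v \<mu>)" if "\<mu> \<in> ?F" for \<mu>
        proof -
          have e: "T j (w (\<mu> ())) = scale (\<mu> ()) (w (\<mu> ()))" using F(3) that by (auto simp: E_def)
          have "T j (T i (w (\<mu> ()))) = T i (T j (w (\<mu> ())))"
            using insert.prems(3)[of j i] \<open>i \<in> I\<close> by simp
          also have "\<dots> = scale (\<mu> ()) (T i (w (\<mu> ())))"
            using e insert.prems(2)[of i] \<open>i \<in> I\<close> by simp
          finally have ee: "T j (T i (w (\<mu> ()))) = scale (\<mu> ()) (T i (w (\<mu> ())))" .
          have m: "T j (x - y) = T j x - T j y" for x y
            using insert.prems(1)[of j "x - y" y] by (simp add: algebra_simps)
          show ?thesis using ee e insert.prems(2)[of j]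
            by (simp add: v_def m scale_right_diff_distrib mult.commute)
        qed
        ultimately have "v (\<lambda>_. c) = 0"
          using insert.prems(1,2)[of j] F(1) \<open>c \<in> F\<close>
          by (intro joint_eigenvectors_independent[of ?F "{()}" "\<lambda>_. T j" v]) (auto simp: fun_eq_iff)
        then show ?thesis by (auto simp: v_def)
      qed
      then show ?thesis using F(3) that by (auto simp: E_def)
    qed
    then show ?thesis unfolding F(4) by (intro span_sum span_base)
  qed
  then have "{y. \<forall>i\<in>I. \<exists>c. T i y = scale c y} \<subseteq> span ?S" by blast
  then have "span {y. \<forall>i\<in>I. \<exists>c. T i y = scale c y} \<subseteq> span ?S"
    by (rule span_minimal) simp
  then show ?case using insert.IH insert.prems by auto
qed

end

text \<open>If \<open>T\<close> preserves the span of the finite independent set \<open>C\<close>, this is the trace of its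
  restriction to this span.\<close>

definition trace_on :: "('a::field \<Rightarrow> 'b::ab_group_add \<Rightarrow> 'b) \<Rightarrow> 'b set \<Rightarrow> ('b \<Rightarrow> 'b) \<Rightarrow> 'a"
  where "trace_on scale C T = (\<Sum>b\<in>C. module.representation scale C (T b) b)"

context vector_space
begin

lemma sum_representation:
  assumes "finite C" "independent C" "v \<in> span C"
  shows "(\<Sum>b\<in>C. scale (representation C v b) b) = v"
proof -
  have "(\<Sum>b\<in>C. scale (representation C v b) b)
      = (\<Sum>b | representation C v b \<noteq> 0. scale (representation C v b) b)"
    using assms by (intro sum.mono_neutral_right) (auto dest: representation_ne_zero)
  then show ?thesis using sum_nonzero_representation_eq[OF assms(2,3)] by simp
qed

lemma trace_on_comp_commute:
  assumes "finite C" "independent C"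
    and S: "Vector_Spaces.linear scale scale S" "\<And>b. b \<in> C \<Longrightarrow> S b \<in> span C"
    and T: "Vector_Spaces.linear scale scale T" "\<And>b. b \<in> C \<Longrightarrow> T b \<in> span C"
  shows "trace_on scale C (\<lambda>v. S (T v)) = trace_on scale C (\<lambda>v. T (S v))"
proof -
  have *: "representation C (S (T b)) b
      = (\<Sum>c\<in>C. representation C (T b) c * representation C (S c) b)" if "b \<in> C"
      "Vector_Spaces.linear scale scale S" "\<And>b. b \<in> C \<Longrightarrow> S b \<in> span C"
      "\<And>b. b \<in> C \<Longrightarrow> T b \<in> span C" for S T b
  proof -
    interpret S: Vector_Spaces.linear scale scale S by (fact that(2))
    have "S (T b) = (\<Sum>c\<in>C. scale (representation C (T b) c) (S c))"
      by (subst sum_representation[OF assms(1,2) that(4)[OF that(1)], symmetric])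
        (simp add: S.sum S.scale)
    also have "representation C \<dots> b = (\<Sum>c\<in>C. representation C (T b) c * representation C (S c) b)"
      using assms(1,2) that
      by (subst representation_sum) (auto simp: representation_scale intro: span_scale)
    finally show ?thesis .
  qed
  have "trace_on scale C (\<lambda>v. S (T v))
      = (\<Sum>b\<in>C. \<Sum>c\<in>C. representation C (T b) c * representation C (S c) b)"
    unfolding trace_on_def using * S T by (intro sum.cong) auto
  also have "\<dots> = (\<Sum>c\<in>C. \<Sum>b\<in>C. representation C (T b) c * representation C (S c) b)"
    by (rule sum.swap)
  also have "\<dots> = trace_on scale C (\<lambda>v. T (S v))"
    unfolding trace_on_def using * S T by (intro sum.cong) (auto simp: mult.commute)
  finally show ?thesis .
qed

lemma trace_on_add:
  assumes "independent C" "\<And>b. b \<in> C \<Longrightarrow> S b \<in> span C" "\<And>b. b \<in> C \<Longrightarrow> T b \<in> span C"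
  shows "trace_on scale C (\<lambda>v. S v + T v) = trace_on scale C S + trace_on scale C T"
  using assms unfolding trace_on_def by (simp add: representation_add sum.distrib)

lemma trace_on_diff:
  assumes "independent C" "\<And>b. b \<in> C \<Longrightarrow> S b \<in> span C" "\<And>b. b \<in> C \<Longrightarrow> T b \<in> span C"
  shows "trace_on scale C (\<lambda>v. S v - T v) = trace_on scale C S - trace_on scale C T"
  using assms unfolding trace_on_def by (simp add: representation_diff sum_subtractf)

lemma trace_on_scale:
  assumes "independent C" "\<And>b. b \<in> C \<Longrightarrow> T b \<in> span C"
  shows "trace_on scale C (\<lambda>v. scale c (T v)) = c * trace_on scale C T"
  using assms unfolding trace_on_def by (simp add: representation_scale sum_distrib_left)

lemma trace_on_diagonal:
  assumes "independent C" "\<And>b. b \<in> C \<Longrightarrow> T b = scale (d b) b"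
  shows "trace_on scale C T = (\<Sum>b\<in>C. d b)"
  using assms unfolding trace_on_def
  by (simp add: representation_scale representation_basis span_base)

end

section \<open>Weights and nilpotent actions in modules\<close>

lemma dual_space_eqI:
  assumes "lie_algebra scale bracket"
    and "\<mu> \<in> lie_algebra.dual_space scale H" "\<nu> \<in> lie_algebra.dual_space scale H"
    and "\<And>h. h \<in> H \<Longrightarrow> \<mu> h = \<nu> h"
  shows "\<mu> = \<nu>"
proof
  fix x show "\<mu> x = \<nu> x"
    using assms(2-) unfolding lie_algebra.dual_space_def[OF assms(1)] by (cases "x \<in> H") auto
qed

context lie_algebra
begin

lemma dual_space_zero: "0 \<in> dual_space H"
  by (simp add: dual_space_def)

lemma dual_space_add: "\<mu> \<in> dual_space H \<Longrightarrow> \<nu> \<in> dual_space H \<Longrightarrow> \<mu> + \<nu> \<in> dual_space H"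
  by (auto simp: dual_space_def algebra_simps)

lemma dual_space_uminus: "\<mu> \<in> dual_space H \<Longrightarrow> - \<mu> \<in> dual_space H"
  by (auto simp: dual_space_def)

end

text \<open>The vectors that are killed by every product of \<open>k\<close> factors from \<open>S\<close>.\<close>

primrec nil_level :: "('g \<Rightarrow> 'm \<Rightarrow> 'm::zero) \<Rightarrow> 'g set \<Rightarrow> nat \<Rightarrow> 'm set"
  where "nil_level act S 0 = {0}"
  | "nil_level act S (Suc k) = {v. \<forall>s\<in>S. act s v \<in> nil_level act S k}"

locale full_module = lie_module scale bracket UNIV scaleM act
  for scale :: "complex \<Rightarrow> 'g::ab_group_add \<Rightarrow> 'g"
    and bracket :: "'g \<Rightarrow> 'g \<Rightarrow> 'g"
    and scaleM :: "complex \<Rightarrow> 'm::ab_group_add \<Rightarrow> 'm"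
    and act :: "'g \<Rightarrow> 'm \<Rightarrow> 'm"
begin

lemmas act_linear =
  act_add_left[OF UNIV_I UNIV_I] act_scale_left[OF UNIV_I]
  act_add_right[OF UNIV_I] act_scale_right[OF UNIV_I]

lemmas act_commutator = act_bracket[OF UNIV_I UNIV_I]

lemma act_zero_right [simp]: "act x 0 = 0"
  using act_linear(4)[of x 0 0] by simp

lemma act_zero_left [simp]: "act 0 v = 0"
  using act_linear(2)[of 0 0 v] by simp

lemma act_minus_right: "act x (- v) = - act x v"
  using act_linear(4)[of x "-1" v] by simp

lemma act_diff_right: "act x (v - w) = act x v - act x w"
  using act_linear(3)[of x v "- w"] by (simp add: act_minus_right)

lemma act_sum_right: "act x (sum f A) = (\<Sum>a\<in>A. act x (f a))"
  by (induction A rule: infinite_finite_induct) (auto simp: act_linear)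

lemma act_sum_left: "act (sum f A) v = (\<Sum>a\<in>A. act (f a) v)"
  by (induction A rule: infinite_finite_induct) (auto simp: act_linear)

lemma subspace_weight_space: "M.subspace (weight_space H scaleM act \<mu>)"
  by (auto simp: M.subspace_def weight_space_def act_linear M.scale_right_distrib mult.commute)

lemma weight_vectors_independent:
  assumes "finite F" "F \<subseteq> dual_space H"
    and "\<And>\<mu>. \<mu> \<in> F \<Longrightarrow> v \<mu> \<in> weight_space H scaleM act \<mu>"
    and "(\<Sum>\<mu>\<in>F. v \<mu>) = 0" and "\<mu> \<in> F"
  shows "v \<mu> = 0"
proof (rule M.joint_eigenvectors_independent[of F H act v])
  show "\<mu> = \<nu>" if "\<mu> \<in> F" "\<nu> \<in> F" "\<And>h. h \<in> H \<Longrightarrow> \<mu> h = \<nu> h" for \<mu> \<nu>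
    using dual_space_eqI[OF lie_algebra_axioms] that assms(2) by blast
qed (use assms act_linear in \<open>auto simp: weight_space_def\<close>)

lemma act_weight:
  assumes "x \<in> root_space H \<alpha>" "v \<in> weight_space H scaleM act \<mu>"
  shows "act x v \<in> weight_space H scaleM act (\<alpha> + \<mu>)"
proof -
  have "act h (act x v) = scaleM ((\<alpha> + \<mu>) h) (act x v)" if "h \<in> H" for h
  proof -
    have "act h (act x v) = act (bracket h x) v + act x (act h v)"
      by (simp add: act_commutator)
    then show ?thesis using assms that
      by (simp add: root_space_def weight_space_def act_linear M.scale_left_distrib)
  qed
  then show ?thesis by (auto simp: weight_space_def)
qed

lemma nil_level_subspace: "M.subspace (nil_level act S k)"
proof (induction k)
  case (Suc k)
  then show ?case
    by (auto simp: M.subspace_def act_linear)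
qed simp

lemma zero_in_nil_level [simp]: "0 \<in> nil_level act S k"
  using nil_level_subspace M.subspace_0 by blast

lemma nil_level_Suc_mono: "nil_level act S k \<subseteq> nil_level act S (Suc k)"
  by (induction k) auto

lemma nil_level_mono: "k \<le> l \<Longrightarrow> nil_level act S k \<subseteq> nil_level act S l"
  using nil_level_Suc_mono by (rule lift_Suc_mono_le)

lemma nil_level_span: "nil_level act (span S) k = nil_level act S k"
proof (induction k)
  case (Suc k)
  have "act s v \<in> nil_level act S k" if "\<forall>s\<in>S. act s v \<in> nil_level act S k" "s \<in> span S" for s v
    using that(2)
  proof (induction rule: span_induct_alt)
    case (step c x y)
    then show ?case using that(1) nil_level_subspace[of S k]
      by (auto simp: act_linear intro!: M.subspace_add M.subspace_scale)
  qed simp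
  then show ?case using Suc span_base by auto
qed simp

lemma nil_level_antimono: "S \<subseteq> T \<Longrightarrow> nil_level act T k \<subseteq> nil_level act S k"
  by (induction k) auto

text \<open>Nonzero vectors of distinct weights are independent.\<close>

lemma finitely_many_weights:
  assumes "finite B" "E \<subseteq> M.span B"
  shows "finite {\<mu> \<in> dual_space H. \<exists>u\<in>E. u \<noteq> 0 \<and> u \<in> weight_space H scaleM act \<mu>}" (is "finite ?W")
proof -
  obtain u where u: "\<And>\<mu>. \<mu> \<in> ?W \<Longrightarrow> u \<mu> \<in> E \<and> u \<mu> \<noteq> 0 \<and> u \<mu> \<in> weight_space H scaleM act \<mu>"
    using bchoice[of ?W "\<lambda>\<mu> v. v \<in> E \<and> v \<noteq> 0 \<and> v \<in> weight_space H scaleM act \<mu>"] by auto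
  have inj: "inj_on u ?W"
  proof (rule inj_onI, rule ccontr)
    fix \<mu> \<nu> assume *: "\<mu> \<in> ?W" "\<nu> \<in> ?W" "u \<mu> = u \<nu>" "\<mu> \<noteq> \<nu>"
    then obtain h where h: "h \<in> H" "\<mu> h \<noteq> \<nu> h"
      using dual_space_eqI[OF lie_algebra_axioms, of \<mu> H \<nu>] by auto
    then have "scaleM (\<mu> h) (u \<mu>) = scaleM (\<nu> h) (u \<mu>)"
      using u[OF *(1)] u[OF *(2)] *(3) by (auto simp: weight_space_def)
    then show False using h u[OF *(1)] by simp
  qed
  have "M.independent (u ` ?W)"
    unfolding M.independent_explicit_module
  proof (intro allI impI)
    fix t c v assume t: "finite t" "t \<subseteq> u ` ?W" "(\<Sum>v\<in>t. scaleM (c v) v) = 0" "v \<in> t"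
    then obtain F where F: "F \<subseteq> ?W" "t = u ` F" by (auto simp: subset_image_iff)
    with t inj have "finite F" using finite_imageD inj_on_subset by blast
    have "(\<Sum>\<mu>\<in>F. scaleM (c (u \<mu>)) (u \<mu>)) = 0"
      using t(3) F sum.reindex[OF inj_on_subset[OF inj F(1)], of "\<lambda>v. scaleM (c v) v"] by simp
    moreover obtain \<mu> where \<mu>: "\<mu> \<in> F" "v = u \<mu>" using F t by auto
    moreover have "scaleM (c (u \<kappa>)) (u \<kappa>) \<in> weight_space H scaleM act \<kappa>" if "\<kappa> \<in> F" for \<kappa>
      using u F that subspace_weight_space M.subspace_scale by blast
    ultimately have "scaleM (c (u \<mu>)) (u \<mu>) = 0"
      using weight_vectors_independent[of F H "\<lambda>\<mu>. scaleM (c (u \<mu>)) (u \<mu>)" \<mu>] \<open>finite F\<close> F by blast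
    moreover have "u \<mu> \<noteq> 0" using u \<mu>(1) F(1) by blast
    ultimately show "c v = 0" using \<mu> by simp
  qed
  moreover have "u ` ?W \<subseteq> M.span B" using u assms(2) by blast
  ultimately have "finite (u ` ?W)" using M.independent_span_bound[OF assms(1)] by blast
  then show ?thesis using inj finite_imageD by blast
qed

text \<open>Each factor raises the weight with respect to the order that \<open>P\<close> defines, and only finitely
  many weights occur.\<close>

lemma weight_vector_nilpotent:
  assumes P: "P \<subseteq> dual_space H" "0 \<notin> P" "\<And>\<alpha> \<beta>. \<alpha> \<in> P \<Longrightarrow> \<beta> \<in> P \<Longrightarrow> \<alpha> + \<beta> \<in> P"
    and S: "S \<subseteq> (\<Union>\<alpha>\<in>P. root_space H \<alpha>)"
    and E: "finite B" "E \<subseteq> M.span B" "\<And>s u. s \<in> S \<Longrightarrow> u \<in> E \<Longrightarrow> act s u \<in> E"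
    and v: "v \<in> E" "v \<in> weight_space H scaleM act \<mu>" "\<mu> \<in> dual_space H"
  shows "\<exists>k. v \<in> nil_level act S k"
proof -
  define W where "W = {\<mu> \<in> dual_space H. \<exists>u\<in>E. u \<noteq> 0 \<and> u \<in> weight_space H scaleM act \<mu>}"
  define X where "X \<mu> = {\<nu> \<in> W. \<nu> = \<mu> \<or> \<nu> - \<mu> \<in> P}" for \<mu>
  have "finite W" unfolding W_def by (rule finitely_many_weights[OF E(1,2)])
  then have finX: "finite (X \<mu>)" for \<mu> by (simp add: X_def)
  have "v \<in> nil_level act S (card (X \<mu>))"
    using v
  proof (induction "card (X \<mu>)" arbitrary: v \<mu> rule: less_induct)
    case less
    show ?case
    proof (cases "v = 0")
      case False
      then have \<mu>: "\<mu> \<in> X \<mu>" using less.prems by (auto simp: X_def W_def)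
      have "act s v \<in> nil_level act S (card (X \<mu>) - 1)" if s: "s \<in> S" for s
      proof -
        obtain \<alpha> where \<alpha>: "\<alpha> \<in> P" "s \<in> root_space H \<alpha>" using S s by blast
        have "\<mu> \<notin> X (\<alpha> + \<mu>)" using P \<alpha>(1) P(3)[of \<alpha> "-\<alpha>"] by (auto simp: X_def)
        moreover have "X (\<alpha> + \<mu>) \<subseteq> X \<mu>"
        proof
          fix \<nu> assume \<nu>: "\<nu> \<in> X (\<alpha> + \<mu>)"
          have "\<nu> - \<mu> = \<alpha> + (\<nu> - (\<alpha> + \<mu>))" by simp
          then have "\<nu> - \<mu> \<in> P" using \<nu> \<alpha>(1) P(3)[of \<alpha> "\<nu> - (\<alpha> + \<mu>)"] by (auto simp: X_def)
          then show "\<nu> \<in> X \<mu>" using \<nu> by (auto simp: X_def)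
        qed
        ultimately have lt: "card (X (\<alpha> + \<mu>)) < card (X \<mu>)"
          using \<mu> finX by (intro psubset_card_mono) auto
        have "act s v \<in> nil_level act S (card (X (\<alpha> + \<mu>)))"
          using less.prems E(3)[OF s] act_weight[OF \<alpha>(2)] \<alpha>(1) P(1)
          by (intro less.hyps[OF lt]) (auto intro: dual_space_add)
        moreover have "card (X (\<alpha> + \<mu>)) \<le> card (X \<mu>) - 1" using lt by linarith
        ultimately show ?thesis using nil_level_mono by blast
      qed
      moreover have "card (X \<mu>) > 0" using \<mu> finX card_gt_0_iff by blast
      ultimately show ?thesis by (cases "card (X \<mu>)") auto
    qed simp
  qed
  then show ?thesis by blast
qed

lemma weight_module_nilpotent:
  assumes P: "P \<subseteq> dual_space H" "0 \<notin> P" "\<And>\<alpha> \<beta>. \<alpha> \<in> P \<Longrightarrow> \<beta> \<in> P \<Longrightarrow> \<alpha> + \<beta> \<in> P"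
    and S: "S \<subseteq> (\<Union>\<alpha>\<in>P. root_space H \<alpha>)"
    and fin: "\<And>v. \<exists>B E. finite B \<and> E \<subseteq> M.span B \<and> (\<forall>s\<in>S. \<forall>u\<in>E. act s u \<in> E) \<and> v \<in> E"
    and wt: "weight_module H scaleM act"
  shows "\<exists>k. v \<in> nil_level act S k"
proof -
  have "v \<in> M.span (\<Union>\<mu>\<in>dual_space H. weight_space H scaleM act \<mu>)"
    using wt by (simp add: weight_module_def)
  then show ?thesis
  proof (induction rule: M.span_induct_alt)
    case base
    show ?case by (intro exI[of _ 0]) simp
  next
    case (step c x y)
    then obtain \<mu> where \<mu>: "\<mu> \<in> dual_space H" "x \<in> weight_space H scaleM act \<mu>" by blast
    obtain B E where "finite B" "E \<subseteq> M.span B" "\<forall>s\<in>S. \<forall>u\<in>E. act s u \<in> E" "x \<in> E"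
      using fin[of x] by blast
    then obtain k where k: "x \<in> nil_level act S k"
      using weight_vector_nilpotent[OF P S, of B E x \<mu>] \<mu> by blast
    from step obtain l where l: "y \<in> nil_level act S l" by blast
    show ?case
      using k l nil_level_mono[of k "max k l" S] nil_level_mono[of l "max k l" S]
        nil_level_subspace[of S "max k l"]
      by (intro exI[of _ "max k l"]) (auto intro!: M.subspace_add M.subspace_scale)
  qed
qed

text \<open>The positive multiples of \<open>\<alpha>\<close> serve as the set \<open>P\<close>.\<close>

lemma root_vector_nilpotent:
  assumes \<alpha>: "\<alpha> \<in> dual_space H" "\<alpha> \<noteq> 0" "z \<in> root_space H \<alpha>"
    and fin: "\<And>v. \<exists>B E. finite B \<and> E \<subseteq> M.span B \<and> (\<forall>s\<in>{z}. \<forall>u\<in>E. act s u \<in> E) \<and> v \<in> E"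
    and wt: "weight_module H scaleM act"
  shows "\<exists>k. v \<in> nil_level act {z} k"
proof (rule weight_module_nilpotent[OF _ _ _ _ fin wt])
  let ?P = "range (\<lambda>n x. of_nat (Suc n) * \<alpha> x)"
  show "?P \<subseteq> dual_space H" using \<alpha>(1) by (auto simp: dual_space_def algebra_simps)
  show "0 \<notin> ?P"
  proof
    assume "0 \<in> ?P"
    then obtain n where n: "0 = (\<lambda>x. of_nat (Suc n) * \<alpha> x)" by blast
    have "\<alpha> x = 0" for x using fun_cong[OF n, of x] by (simp del: of_nat_Suc)
    then show False using \<alpha>(2) by (auto simp: fun_eq_iff)
  qed
  show "\<beta> + \<gamma> \<in> ?P" if \<beta>\<gamma>: "\<beta> \<in> ?P" "\<gamma> \<in> ?P" for \<beta> \<gamma>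
  proof -
    obtain m n where "\<beta> = (\<lambda>x. of_nat (Suc m) * \<alpha> x)" "\<gamma> = (\<lambda>x. of_nat (Suc n) * \<alpha> x)"
      using \<beta>\<gamma> by blast
    then have "\<beta> + \<gamma> = (\<lambda>x. of_nat (Suc (Suc (m + n))) * \<alpha> x)"
      by (auto simp: fun_eq_iff algebra_simps)
    then show ?thesis by (intro range_eqI[of _ _ "Suc (m + n)"])
  qed
  show "{z} \<subseteq> (\<Union>\<alpha>\<in>?P. root_space H \<alpha>)" using \<alpha>(3) by (auto intro!: exI[of _ 0])
qed

lemma finite_dim_stable:
  assumes "finite_dim scaleM UNIV"
  shows "\<exists>B E. finite B \<and> E \<subseteq> M.span B \<and> (\<forall>s\<in>S. \<forall>u\<in>E. act s u \<in> E) \<and> v \<in> E"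
proof -
  obtain B where "finite B" "M.span B = UNIV" using assms by (auto simp: finite_dim_def)
  then show ?thesis by (intro exI[of _ B] exI[of _ UNIV]) auto
qed

lemma locally_finite_stable:
  assumes "locally_finite L scaleM act" "S \<subseteq> L"
  shows "\<exists>B E. finite B \<and> E \<subseteq> M.span B \<and> (\<forall>s\<in>S. \<forall>u\<in>E. act s u \<in> E) \<and> v \<in> E"
proof -
  let ?E = "generated_submodule L scaleM act {v}"
  obtain B where "finite B" "M.span B = ?E"
    using assms(1) by (auto simp: locally_finite_def finite_dim_def)
  moreover have "\<forall>s\<in>S. \<forall>u\<in>?E. act s u \<in> ?E" "v \<in> ?E"
    using assms(2) by (auto simp: generated_submodule_def lie_submodule_def)
  ultimately show ?thesis by (intro exI[of _ B] exI[of _ ?E]) auto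
qed

lemma nilpotent_uniform:
  assumes "finite_dim scaleM UNIV" "\<And>v. \<exists>k. v \<in> nil_level act S k"
  shows "\<exists>k. nil_level act S k = UNIV"
proof -
  obtain B where B: "finite B" "M.span B = UNIV" using assms(1) by (auto simp: finite_dim_def)
  obtain k where k: "\<And>b. b \<in> nil_level act S (k b)" using assms(2) by metis
  have "b \<in> nil_level act S (Max (k ` B))" if "b \<in> B" for b
    using k[of b] nil_level_mono[of "k b" "Max (k ` B)" S] that B by auto
  then have "M.span B \<subseteq> nil_level act S (Max (k ` B))"
    by (intro M.span_minimal nil_level_subspace) auto
  then show ?thesis using B by auto
qed

end

section \<open>Weakly closed sets of nilpotent operators\<close>

context lie_algebra
begin

lemma full_module_adjoint: "full_module scale bracket scale bracket"
proof unfold_locales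
  show "bracket (bracket x y) v = bracket x (bracket y v) - bracket y (bracket x v)" for x y v
  proof -
    have anti: "bracket a b = - bracket b a" for a b
      using bracket_self[of "a + b"] bracket_self[of a] bracket_self[of b]
      by (simp add: bracket_add_left bracket_add_right eq_neg_iff_add_eq_0 add.commute)
    have neg: "bracket a (- b) = - bracket a b" for a b
      using bracket_scale_right[of a "-1" b] by simp
    show ?thesis
      using jacobi[of x y v] anti[of "bracket x y" v] anti[of v x]
      by (simp add: neg algebra_simps)
  qed
qed (auto simp: subalgebra_def bracket_add_left bracket_add_right bracket_scale_left
    bracket_scale_right)

sublocale ad: full_module scale bracket scale bracket
  by (rule full_module_adjoint)

lemma bracket_commute: "bracket x y = - bracket y x"
  using bracket_self[of "x + y"] bracket_self[of x] bracket_self[of y]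
  by (simp add: bracket_add_left bracket_add_right eq_neg_iff_add_eq_0 add.commute)

lemma bracket_span_span:
  assumes "\<And>a b. a \<in> A \<Longrightarrow> b \<in> B \<Longrightarrow> bracket a b \<in> span C" "x \<in> span A" "y \<in> span B"
  shows "bracket x y \<in> span C"
  using assms(2)
proof (induction rule: span_induct_alt)
  case base
  show ?case by (simp add: span_zero)
next
  case (step c a x)
  have "bracket a y \<in> span C"
    using assms(3)
  proof (induction rule: span_induct_alt)
    case base
    show ?case by (simp add: span_zero)
  next
    case (step d b y)
    then show ?case using assms(1) \<open>a \<in> A\<close>
      by (auto simp: ad.act_linear intro!: span_add span_scale)
  qed
  then show ?case using step by (auto simp: ad.act_linear intro!: span_add span_scale)
qed

text \<open>Descending in the filtration by the levels, some element outside the span of \<open>A\<close> is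
  normalised by \<open>A\<close>; it can be taken in \<open>G\<close> since \<open>G\<close> is closed under the bracket.\<close>

lemma normalizing_element_exists:
  assumes "\<And>x y. x \<in> G \<Longrightarrow> y \<in> G \<Longrightarrow> bracket x y \<in> G" "A \<subseteq> G"
    and "z \<in> G" "z \<notin> span A" "z \<in> nil_level bracket A k"
  shows "\<exists>z\<in>G. z \<notin> span A \<and> (\<forall>a\<in>A. bracket a z \<in> span A)"
  using assms(3-)
proof (induction k arbitrary: z)
  case 0
  then show ?case by (auto simp: span_zero)
next
  case (Suc k)
  show ?case
  proof (cases "\<forall>a\<in>A. bracket a z \<in> span A")
    case False
    then obtain a where "a \<in> A" "bracket a z \<notin> span A" by blast
    then show ?thesis using Suc assms(1,2) by (intro Suc.IH[of "bracket a z"]) auto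
  qed (use Suc in blast)
qed

text \<open>The levels of \<open>A\<close> are stable under \<open>z\<close> since \<open>z\<close> normalises \<open>A\<close>. Each step of this
  filtration can thus be refined by the kernels of the powers of \<open>z\<close>, which are at most \<open>m\<close> in
  number.\<close>

lemma nil_level_insert:
  assumes "\<And>a. a \<in> A \<Longrightarrow> bracket a z \<in> span A" and "nil_level bracket {z} m = UNIV"
  shows "nil_level bracket A k \<subseteq> nil_level bracket (insert z A) (k * m)"
proof -
  have stable: "bracket z v \<in> nil_level bracket A k" if "v \<in> nil_level bracket A k" for k v
    using that
  proof (induction k arbitrary: v)
    case (Suc k)
    have "bracket a (bracket z v) \<in> nil_level bracket A k" if a: "a \<in> A" for a
    proof -
      have "bracket (bracket a z) v \<in> nil_level bracket A k"
        using Suc.prems assms(1)[OF a] ad.nil_level_span[of A "Suc k"]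
          ad.nil_level_span[of A k] by auto
      moreover have "bracket z (bracket a v) \<in> nil_level bracket A k"
        using Suc a by auto
      moreover have "bracket a (bracket z v) = bracket (bracket a z) v + bracket z (bracket a v)"
        using ad.act_commutator[of a z v] by simp
      ultimately show ?thesis using subspace_add[OF ad.nil_level_subspace] by simp
    qed
    then show ?case by simp
  qed simp
  show ?thesis
  proof (induction k)
    case (Suc k)
    have "v \<in> nil_level bracket (insert z A) (k * m + j)"
      if "v \<in> nil_level bracket {z} j" "v \<in> nil_level bracket A (Suc k)" for v j
      using that
    proof (induction j arbitrary: v)
      case (Suc j)
      have "bracket z v \<in> nil_level bracket (insert z A) (k * m + j)"
        using Suc.prems(1) stable[OF Suc.prems(2)] by (intro Suc.IH) auto
      moreover have "bracket a v \<in> nil_level bracket (insert z A) (k * m + j)" if "a \<in> A" for a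
        using Suc.prems that \<open>nil_level bracket A k \<subseteq> nil_level bracket (insert z A) (k * m)\<close>
          ad.nil_level_mono[of "k * m" "k * m + j" "insert z A"] by auto
      ultimately show ?case by simp
    qed simp
    from this[of _ m] show ?case using assms(2) by (auto simp: add.commute)
  qed simp
qed

text \<open>As in the proof of Engel's theorem, a maximal independent subset \<open>A\<close> of \<open>G\<close> that acts nilpotently
  and spans a subalgebra must span \<open>G\<close>: otherwise an element of \<open>G\<close> that normalises \<open>A\<close> could
  be added.\<close>

theorem weakly_closed_nilpotent:
  assumes fin: "finite_dim scale UNIV"
    and closed: "\<And>x y. x \<in> G \<Longrightarrow> y \<in> G \<Longrightarrow> bracket x y \<in> G"
    and nil: "\<And>z. z \<in> G \<Longrightarrow> \<exists>m. nil_level bracket {z} m = UNIV"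
  shows "\<exists>k. nil_level bracket G k = UNIV"
proof -
  obtain B where B: "finite B" "span B = UNIV" using fin by (auto simp: finite_dim_def)
  define Q where "Q A \<longleftrightarrow> A \<subseteq> G \<and> independent A \<and> (\<forall>a\<in>A. \<forall>b\<in>A. bracket a b \<in> span A) \<and>
    (\<exists>k. nil_level bracket A k = UNIV)" for A
  have "Q {}" by (auto simp: Q_def independent_empty intro!: exI[of _ 1])
  moreover have "card A < Suc (card B)" if "Q A" for A
    using independent_span_bound[OF B(1), of A] B(2) that by (auto simp: Q_def)
  ultimately obtain A where A: "Q A" and max: "\<And>A'. Q A' \<Longrightarrow> card A' \<le> card A"
    using ex_has_greatest_nat[of Q "{}" card "Suc (card B)"] by blast
  obtain k where k: "nil_level bracket A k = UNIV" using A by (auto simp: Q_def)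
  have "G \<subseteq> span A"
  proof (rule ccontr)
    assume "\<not> G \<subseteq> span A"
    then obtain y where "y \<in> G" "y \<notin> span A" by blast
    then have "\<exists>z\<in>G. z \<notin> span A \<and> (\<forall>a\<in>A. bracket a z \<in> span A)"
      using A k by (intro normalizing_element_exists[of G A y k] closed) (auto simp: Q_def)
    then obtain z where z: "z \<in> G" "z \<notin> span A" "\<forall>a\<in>A. bracket a z \<in> span A" by blast
    obtain m where m: "nil_level bracket {z} m = UNIV" using nil z by blast
    have "nil_level bracket (insert z A) (k * m) = UNIV"
      using nil_level_insert[of A z m k] z m k by auto
    moreover have "bracket a b \<in> span (insert z A)" if "a \<in> insert z A" "b \<in> insert z A" for a b
    proof -
      have "bracket a b \<in> span A"
        using that z A bracket_commute[of z b] span_neg span_zero bracket_self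
        by (auto simp: Q_def)
      then show ?thesis using span_mono[of A "insert z A"] by blast
    qed
    moreover have "independent (insert z A)"
      using A z by (intro independent_insertI) (auto simp: Q_def)
    ultimately have "Q (insert z A)"
      using A z by (auto simp: Q_def)
    moreover have "card (insert z A) = Suc (card A)"
      using z span_base independent_span_bound[OF B(1), of A] B(2) A
      by (subst card_insert_disjoint) (auto simp: Q_def)
    ultimately show False using max by fastforce
  qed
  then show ?thesis using k ad.nil_level_antimono[of G "span A" k] ad.nil_level_span[of A k] by auto
qed

text \<open>Apply elements of \<open>G\<close> to \<open>x\<close> as long as the result is nonzero. Each application lowers the
  level.\<close>

lemma annihilated_element_exists:
  assumes "x \<in> J" "x \<noteq> 0" "x \<in> nil_level bracket G k"
    and "\<And>s x. s \<in> G \<Longrightarrow> x \<in> J \<Longrightarrow> bracket s x \<in> J"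
  shows "\<exists>x\<in>J. x \<noteq> 0 \<and> (\<forall>s\<in>G. bracket s x = 0)"
  using assms(1-3)
proof (induction k arbitrary: x)
  case (Suc k)
  show ?case
  proof (cases "\<forall>s\<in>G. bracket s x = 0")
    case False
    then obtain s where s: "s \<in> G" "bracket s x \<noteq> 0" by blast
    then show ?thesis using Suc assms(4) by (intro Suc.IH[of "bracket s x"]) auto
  qed (use Suc in blast)
qed simp

lemma semisimple_abelian_ideal:
  assumes "semisimple" "lie_ideal A" "\<And>x y. x \<in> A \<Longrightarrow> y \<in> A \<Longrightarrow> bracket x y = 0"
  shows "A = {0}"
proof -
  have "0 \<in> A" using assms(2) by (auto simp: lie_ideal_def subspace_0)
  then have "{bracket x y |x y. x \<in> A \<and> y \<in> A} = {0}" using assms(3) by force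
  then have "derived A = {0}" by (simp add: derived_def)
  then have "solvable A" unfolding solvable_def by (intro exI[of _ 1]) simp
  then show ?thesis using assms by (auto simp: semisimple_def)
qed

lemma semisimple_centre:
  assumes "semisimple" "\<And>y. bracket x y = 0"
  shows "x = 0"
proof -
  let ?Z = "{x. \<forall>y. bracket x y = 0}"
  have "bracket x y \<in> ?Z" if "y \<in> ?Z" for x y
    using that bracket_commute[of x y] by auto
  then have "lie_ideal ?Z"
    unfolding lie_ideal_def by (auto simp: subspace_def ad.act_linear)
  then have "?Z = {0}" by (rule semisimple_abelian_ideal[OF assms(1)]) auto
  then show ?thesis using assms(2) by auto
qed

text \<open>A nonzero ideal that acts nilpotently would have a nonzero centre, and this centre is an
  abelian ideal of the whole algebra.\<close>

theorem nilpotent_ideal_trivial: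
  assumes "semisimple" "lie_ideal J" "nil_level bracket J k = UNIV"
  shows "J = {0}"
proof (rule ccontr)
  assume "J \<noteq> {0}"
  moreover have J: "0 \<in> J" "\<And>x y. y \<in> J \<Longrightarrow> bracket x y \<in> J"
    using assms(2) by (auto simp: lie_ideal_def subspace_0)
  ultimately obtain x where "x \<in> J" "x \<noteq> 0" by blast
  then obtain x where x: "x \<in> J" "x \<noteq> 0" "\<forall>s\<in>J. bracket s x = 0"
    using annihilated_element_exists[of x J J k] J assms(3) by auto
  let ?C = "{x \<in> J. \<forall>s\<in>J. bracket s x = 0}"
  have "bracket y z \<in> ?C" if z: "z \<in> ?C" for y z
  proof -
    have "bracket s (bracket y z) = 0" if s: "s \<in> J" for s
    proof -
      have "bracket s (bracket y z) = bracket (bracket s y) z + bracket y (bracket s z)"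
        using ad.act_commutator[of s y z] by simp
      also have "bracket s y \<in> J"
        using J(2)[OF s, of y] bracket_commute[of s y] assms(2) subspace_neg
        by (auto simp: lie_ideal_def)
      then have "bracket (bracket s y) z = 0" using z by blast
      finally show ?thesis using z s by simp
    qed
    then show ?thesis using z J by auto
  qed
  then have "lie_ideal ?C"
    using assms(2) unfolding lie_ideal_def by (auto simp: subspace_def ad.act_linear)
  then have "?C = {0}" by (rule semisimple_abelian_ideal[OF assms(1)]) auto
  then show False using x by auto
qed

end

section \<open>The Killing form and the root decomposition\<close>

locale cartan_setting = lie_algebra scale bracket
  for scale :: "complex \<Rightarrow> 'g::ab_group_add \<Rightarrow> 'g"
    and bracket :: "'g \<Rightarrow> 'g \<Rightarrow> 'g" +
  fixes H :: "'g set"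
  assumes finite_dimensional: "finite_dim scale UNIV"
    and semisimple_algebra: "semisimple"
    and cartan: "cartan_subalgebra H"
begin

lemma subspace_H: "subspace H"
  using cartan by (auto simp: cartan_subalgebra_def toral_def subalgebra_def)

lemma H_abelian: "x \<in> H \<Longrightarrow> y \<in> H \<Longrightarrow> bracket x y = 0"
  using cartan by (auto simp: cartan_subalgebra_def toral_def)

lemma root_space_zero: "root_space H 0 = H"
  using cartan
  by (auto simp: cartan_subalgebra_def centralizer_def root_space_def weight_space_def)

lemma dual_space_D:
  assumes "\<mu> \<in> dual_space H"
  shows "x \<in> H \<Longrightarrow> y \<in> H \<Longrightarrow> \<mu> (x + y) = \<mu> x + \<mu> y" "x \<in> H \<Longrightarrow> \<mu> (scale c x) = c * \<mu> x"
  using assms by (auto simp: dual_space_def)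

lemma dual_space_sum:
  assumes "\<mu> \<in> dual_space H" "\<And>a. a \<in> A \<Longrightarrow> f a \<in> H"
  shows "\<mu> (sum f A) = (\<Sum>a\<in>A. \<mu> (f a))"
  using assms(2)
proof (induction A rule: infinite_finite_induct)
  case (insert a A)
  then show ?case using dual_space_D(1)[OF assms(1)] subspace_sum[OF subspace_H, of A f] by simp
qed (use dual_space_D(2)[OF assms(1), of 0 0] subspace_0[OF subspace_H] in auto)

lemma dual_space_nonzero: "\<mu> \<in> dual_space H \<Longrightarrow> \<mu> \<noteq> 0 \<Longrightarrow> \<exists>h\<in>H. \<mu> h \<noteq> 0"
  using dual_space_eqI[OF lie_algebra_axioms _ dual_space_zero] by auto

lemma bracket_root_space:
  "x \<in> root_space H \<alpha> \<Longrightarrow> y \<in> root_space H \<beta> \<Longrightarrow> bracket x y \<in> root_space H (\<alpha> + \<beta>)"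
  using ad.act_weight[of x H \<alpha> y \<beta>] by (simp add: root_space_def)

lemma subspace_root_space: "subspace (root_space H \<alpha>)"
  unfolding root_space_def by (rule ad.subspace_weight_space)

lemma root_spaceD: "x \<in> root_space H \<alpha> \<Longrightarrow> h \<in> H \<Longrightarrow> bracket h x = scale (\<alpha> h) x"
  by (auto simp: root_space_def weight_space_def)

text \<open>A basis of \<open>H\<close> acts by commuting diagonalizable operators. On a joint eigenvector the eigenvalue
  depends linearly on the element of \<open>H\<close>, so that it is a functional.\<close>

lemma adjoint_weight_module: "weight_module H scale bracket"
proof -
  obtain F where F: "F \<subseteq> H" "independent F" "H \<subseteq> span F"
    using maximal_independent_subset by blast
  obtain B0 where "finite B0" "span B0 = UNIV"
    using finite_dimensional by (auto simp: finite_dim_def)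
  then have "finite F" using independent_span_bound[of B0 F] F by auto
  let ?S = "{y. \<forall>h\<in>F. \<exists>c. bracket h y = scale c y}"
  have "span ?S = UNIV"
  proof (rule simultaneously_diagonalizable[OF \<open>finite F\<close>])
    show "bracket i (bracket j x) = bracket j (bracket i x)" if "i \<in> F" "j \<in> F" for i j x
    proof -
      have "bracket i j = 0" using H_abelian that F(1) by blast
      then show ?thesis using ad.act_commutator[of i j x] by simp
    qed
    show "span {y. \<exists>c. bracket i y = scale c y} = UNIV" if "i \<in> F" for i
      using cartan that F(1) by (auto simp: cartan_subalgebra_def toral_def ad_diagonalizable_def)
  qed (simp_all add: ad.act_linear)
  moreover have "?S \<subseteq> (\<Union>\<mu>\<in>dual_space H. weight_space H scale bracket \<mu>)"
  proof
    fix y assume y: "y \<in> ?S"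
    show "y \<in> (\<Union>\<mu>\<in>dual_space H. weight_space H scale bracket \<mu>)"
    proof (cases "y = 0")
      case True
      then show ?thesis using dual_space_zero subspace_0[OF ad.subspace_weight_space] by blast
    next
      case False
      have "\<exists>c. bracket h y = scale c y" if "h \<in> H" for h
      proof -
        have "h \<in> span F" using that F by blast
        then show ?thesis
        proof (induction rule: span_induct_alt)
          case base
          show ?case by (rule exI[of _ 0]) simp
        next
          case (step c x z)
          then obtain a b where "bracket x y = scale a y" "bracket z y = scale b y" using y by blast
          then show ?case
            by (intro exI[of _ "c * a + b"]) (simp add: ad.act_linear scale_left_distrib)
        qed
      qed
      then obtain m where m: "\<And>h. h \<in> H \<Longrightarrow> bracket h y = scale (m h) y" by metis
      define \<mu> where "\<mu> h = (if h \<in> H then m h else 0)" for h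
      have "\<mu> (a + b) = \<mu> a + \<mu> b" if "a \<in> H" "b \<in> H" for a b
      proof -
        have "a + b \<in> H" using that subspace_H subspace_add by blast
        then have "scale (m (a + b)) y = scale (m a + m b) y"
          using that m[of "a + b"] m[of a] m[of b] by (simp add: ad.act_linear scale_left_distrib)
        then show ?thesis using False \<open>a + b \<in> H\<close> that by (simp add: \<mu>_def)
      qed
      moreover have "\<mu> (scale c a) = c * \<mu> a" if "a \<in> H" for c a
      proof -
        have "scale c a \<in> H" using that subspace_H subspace_scale by blast
        have "bracket (scale c a) y = scale (c * m a) y"
          using that m[of a] by (simp add: ad.act_linear)
        then have "scale (m (scale c a)) y = scale (c * m a) y"
          using m[OF \<open>scale c a \<in> H\<close>] by simp
        then show ?thesis using False \<open>scale c a \<in> H\<close> that by (simp add: \<mu>_def)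
      qed
      ultimately have "\<mu> \<in> dual_space H" by (auto simp: dual_space_def \<mu>_def)
      moreover have "y \<in> weight_space H scale bracket \<mu>" using m by (auto simp: weight_space_def \<mu>_def)
      ultimately show ?thesis by blast
    qed
  qed
  ultimately show ?thesis unfolding weight_module_def using span_mono by blast
qed

lemma weight_basis_exists:
  "\<exists>B wt. finite B \<and> independent B \<and> span B = UNIV \<and>
    (\<forall>b\<in>B. wt b \<in> dual_space H \<and> b \<in> root_space H (wt b))"
proof -
  let ?U = "\<Union>\<mu>\<in>dual_space H. weight_space H scale bracket \<mu>"
  obtain B where B: "B \<subseteq> ?U" "independent B" "?U \<subseteq> span B"
    using maximal_independent_subset by blast
  have "span ?U \<subseteq> span B" using B(3) by (rule span_minimal) simp
  then have "span B = UNIV" using adjoint_weight_module by (auto simp: weight_module_def)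
  moreover obtain B0 where "finite B0" "span B0 = UNIV"
    using finite_dimensional by (auto simp: finite_dim_def)
  then have "finite B" using independent_span_bound[of B0 B] B by auto
  moreover have "\<forall>b\<in>B. \<exists>\<mu>. \<mu> \<in> dual_space H \<and> b \<in> root_space H \<mu>"
    using B(1) by (auto simp: root_space_def)
  then obtain wt where "\<forall>b\<in>B. wt b \<in> dual_space H \<and> b \<in> root_space H (wt b)" by metis
  ultimately show ?thesis using B(2) by blast
qed

end

locale weight_basis = cartan_setting +
  fixes B :: "'a set" and wt :: "'a \<Rightarrow> 'a \<Rightarrow> complex"
  assumes finite_B: "finite B" and independent_B: "independent B" and span_B: "span B = UNIV"
    and wt_dual: "b \<in> B \<Longrightarrow> wt b \<in> dual_space H"
    and wt_root_space: "b \<in> B \<Longrightarrow> b \<in> root_space H (wt b)"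
begin

abbreviation coeff :: "'a \<Rightarrow> 'a \<Rightarrow> complex"
  where "coeff \<equiv> representation B"

lemma B_nonzero: "b \<in> B \<Longrightarrow> b \<noteq> 0"
  using independent_B dependent_zero by blast

lemma coeff_expansion: "(\<Sum>b\<in>B. scale (coeff v b) b) = v"
  using sum_representation[OF finite_B independent_B] span_B by auto

lemma wt_eq_zero: "b \<in> B \<Longrightarrow> wt b = 0 \<Longrightarrow> b \<in> H"
  using wt_root_space[of b] root_space_zero by simp

lemma coeff_weight:
  assumes "v \<in> root_space H \<mu>" "\<mu> \<in> dual_space H" "coeff v b \<noteq> 0"
  shows "wt b = \<mu>"
proof -
  have b: "b \<in> B" using assms(3) by (rule representation_ne_zero)
  show ?thesis
  proof (rule dual_space_eqI[OF lie_algebra_axioms wt_dual[OF b] assms(2)])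
    fix h assume h: "h \<in> H"
    have "bracket h v = (\<Sum>b\<in>B. scale (coeff v b) (bracket h b))"
      by (subst coeff_expansion[of v, symmetric]) (simp add: ad.act_sum_right ad.act_linear)
    also have "\<dots> = (\<Sum>b\<in>B. scale (coeff v b * wt b h) b)"
      using root_spaceD[OF wt_root_space h] by (intro sum.cong) auto
    finally have "(\<Sum>b\<in>B. scale (coeff v b * wt b h) b) = scale (\<mu> h) v"
      using root_spaceD[OF assms(1) h] by simp
    also have "\<dots> = (\<Sum>b\<in>B. scale (\<mu> h * coeff v b) b)"
      by (subst coeff_expansion[of v, symmetric]) (simp add: scale_sum_right)
    finally have "(\<Sum>b\<in>B. scale (coeff v b * wt b h - \<mu> h * coeff v b) b) = 0"
      by (simp add: scale_left_diff_distrib sum_subtractf)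
    then have "coeff v b * wt b h - \<mu> h * coeff v b = 0"
      by (rule independentD[OF independent_B finite_B subset_refl _ b])
    then show "wt b h = \<mu> h" using assms(3) by (simp add: mult.commute)
  qed
qed

lemma root_space_span:
  assumes "v \<in> root_space H \<mu>" "\<mu> \<in> dual_space H"
  shows "v \<in> span {b \<in> B. wt b = \<mu>}"
proof -
  have "(\<Sum>b\<in>B. scale (coeff v b) b) \<in> span {b \<in> B. wt b = \<mu>}"
  proof (rule span_sum)
    fix b assume "b \<in> B"
    then show "scale (coeff v b) b \<in> span {b \<in> B. wt b = \<mu>}"
      using coeff_weight[OF assms, of b]
      by (cases "coeff v b = 0") (auto simp: span_zero intro: span_scale span_base)
  qed
  then show ?thesis by (simp add: coeff_expansion)
qed

lemma H_eqI:
  assumes "h \<in> H" "\<And>b. b \<in> B \<Longrightarrow> wt b h = 0"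
  shows "h = 0"
proof (rule semisimple_centre[OF semisimple_algebra])
  fix y
  have "bracket h (\<Sum>b\<in>B. scale (coeff y b) b) = 0"
    using root_spaceD[OF wt_root_space assms(1)] assms(2)
    by (simp add: ad.act_sum_right ad.act_linear)
  then show "bracket h y = 0" by (simp add: coeff_expansion)
qed

lemma linear_bracket: "Vector_Spaces.linear scale scale (bracket x)"
  by unfold_locales (auto simp: ad.act_linear)

lemma bracket_opposite_in_H:
  assumes "x \<in> root_space H \<alpha>" "y \<in> root_space H (- \<alpha>)"
  shows "bracket x y \<in> H"
  using bracket_root_space[OF assms] root_space_zero by simp

text \<open>A commutator has trace zero on every subspace that both factors preserve.\<close>

lemma sum_weights_commutator:
  assumes "\<alpha> \<in> dual_space H" "x \<in> root_space H \<alpha>" "y \<in> root_space H (- \<alpha>)" "C \<subseteq> B"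
    and closed: "\<And>b c. b \<in> C \<Longrightarrow> c \<in> B \<Longrightarrow> wt c = wt b + \<alpha> \<or> wt c = wt b - \<alpha> \<Longrightarrow> c \<in> C"
  shows "(\<Sum>b\<in>C. wt b (bracket x y)) = 0"
proof -
  have indep: "independent C" using independent_B assms(4) independent_mono by blast
  have fin: "finite C" using finite_B assms(4) finite_subset by blast
  have stable: "bracket z b \<in> span C"
    if "b \<in> C" "z \<in> root_space H \<beta>" "\<beta> = \<alpha> \<or> \<beta> = - \<alpha>" for z b \<beta>
  proof -
    have b: "b \<in> B" using that assms(4) by blast
    have "bracket z b \<in> root_space H (\<beta> + wt b)"
      using that(2) wt_root_space[OF b] by (rule bracket_root_space)
    moreover have "\<beta> + wt b \<in> dual_space H"
      using that(3) assms(1) wt_dual[OF b] dual_space_uminus dual_space_add by blast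
    ultimately have "bracket z b \<in> span {c \<in> B. wt c = \<beta> + wt b}" by (rule root_space_span)
    moreover have "{c \<in> B. wt c = \<beta> + wt b} \<subseteq> C"
      using closed[OF that(1)] that(3) by (auto simp: add.commute)
    ultimately show ?thesis using span_mono by blast
  qed
  have x_span: "bracket x v \<in> span C" if "v \<in> span C" for v
    using bracket_span_span[of "{x}" C C x v] stable[OF _ assms(2)] that span_base[of x "{x}"] by auto
  have y_span: "bracket y v \<in> span C" if "v \<in> span C" for v
    using bracket_span_span[of "{y}" C C y v] stable[OF _ assms(3)] that span_base[of y "{y}"] by auto
  have "(\<Sum>b\<in>C. wt b (bracket x y)) = trace_on scale C (bracket (bracket x y))"
    using root_spaceD[OF wt_root_space bracket_opposite_in_H[OF assms(2,3)]] assms(4)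
    by (intro trace_on_diagonal[symmetric] indep) auto
  also have "\<dots> = trace_on scale C (\<lambda>v. bracket x (bracket y v) - bracket y (bracket x v))"
    by (rule arg_cong[of _ _ "trace_on scale C"], rule ext, rule ad.act_commutator)
  also have "\<dots> = trace_on scale C (\<lambda>v. bracket x (bracket y v))
      - trace_on scale C (\<lambda>v. bracket y (bracket x v))"
    using x_span y_span span_base by (intro trace_on_diff indep) auto
  also have "\<dots> = 0"
    using trace_on_comp_commute[OF fin indep linear_bracket _ linear_bracket, of x y]
      x_span y_span span_base by simp
  finally show ?thesis .
qed

text \<open>The trace of the commutator on the \<open>\<alpha>\<close>-string through a weight vanishes, which expresses this
  weight as a rational multiple of \<open>\<alpha>\<close> on \<open>bracket x y\<close>.\<close>

lemma weight_commutator_multiple: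
  assumes "\<alpha> \<in> dual_space H" "x \<in> root_space H \<alpha>" "y \<in> root_space H (- \<alpha>)" "b \<in> B"
  shows "\<exists>r::real. wt b (bracket x y) = of_real r * \<alpha> (bracket x y)"
proof -
  let ?h = "bracket x y"
  define C where "C = {c \<in> B. \<exists>n::int. \<forall>z. wt c z = wt b z + of_int n * \<alpha> z}"
  have "b \<in> C" using assms(4) by (auto simp: C_def intro!: exI[of _ 0])
  have fin: "finite C" using finite_B by (simp add: C_def)
  have "(\<Sum>c\<in>C. wt c ?h) = 0"
  proof (rule sum_weights_commutator[OF assms(1-3)])
    fix c d assume c: "c \<in> C" and d: "d \<in> B" "wt d = wt c + \<alpha> \<or> wt d = wt c - \<alpha>"
    obtain n :: int where n: "\<And>z. wt c z = wt b z + of_int n * \<alpha> z" using c by (auto simp: C_def)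
    from d(2) have "(\<forall>z. wt d z = wt c z + \<alpha> z) \<or> (\<forall>z. wt d z = wt c z - \<alpha> z)"
      by auto
    then have "(\<forall>z. wt d z = wt b z + of_int (n + 1) * \<alpha> z) \<or>
        (\<forall>z. wt d z = wt b z + of_int (n - 1) * \<alpha> z)"
      by (elim disjE) (simp_all add: n algebra_simps)
    then show "d \<in> C" using d(1) unfolding C_def by blast
  qed (auto simp: C_def)
  moreover obtain n where n: "\<And>c z. c \<in> C \<Longrightarrow> wt c z = wt b z + of_int (n c :: int) * \<alpha> z"
    using bchoice[of C "\<lambda>c n. \<forall>z. wt c z = wt b z + of_int (n :: int) * \<alpha> z"]
    by (auto simp: C_def)
  ultimately have "of_nat (card C) * wt b ?h + of_int (\<Sum>c\<in>C. n c) * \<alpha> ?h = 0"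
    by (simp add: sum.distrib sum_distrib_right)
  moreover have "card C \<noteq> 0" using \<open>b \<in> C\<close> fin by auto
  ultimately have "wt b ?h = of_real (- of_int (\<Sum>c\<in>C. n c) / of_nat (card C)) * \<alpha> ?h"
    by (simp add: field_simps eq_neg_iff_add_eq_0 del: of_int_sum)
  then show ?thesis by blast
qed

definition killing :: "'a \<Rightarrow> 'a \<Rightarrow> complex"
  where "killing x y = trace_on scale B (\<lambda>v. bracket x (bracket y v))"

lemma killing_linear:
  "killing (x + y) z = killing x z + killing y z"
  "killing x (y + z) = killing x y + killing x z"
  "killing (scale c x) y = c * killing x y"
  "killing x (scale c y) = c * killing x y"
  using span_B
  by (simp_all add: killing_def ad.act_linear trace_on_add[OF independent_B]
      trace_on_scale[OF independent_B])

lemma killing_sym: "killing x y = killing y x"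
  unfolding killing_def
  by (rule trace_on_comp_commute[OF finite_B independent_B linear_bracket _ linear_bracket])
    (simp_all add: span_B)

lemma killing_zero [simp]: "killing 0 x = 0" "killing x 0 = 0"
  using killing_linear(3)[of 0 0 x] killing_linear(4)[of x 0 0] by simp_all

lemma killing_sum_left: "killing (sum f A) y = (\<Sum>a\<in>A. killing (f a) y)"
  by (induction A rule: infinite_finite_induct) (auto simp: killing_linear)

lemma killing_sum_right: "killing y (sum f A) = (\<Sum>a\<in>A. killing y (f a))"
  by (induction A rule: infinite_finite_induct) (auto simp: killing_linear)

lemma killing_minus: "killing (- x) y = - killing x y" "killing x (- y) = - killing x y"
  using killing_linear(3)[of "-1" x y] killing_linear(4)[of x "-1" y] by simp_all

lemma killing_invariant: "killing (bracket x y) z = killing x (bracket y z)"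
proof -
  have "Vector_Spaces.linear scale scale (\<lambda>v. bracket x (bracket z v))"
    by unfold_locales (auto simp: ad.act_linear)
  then have "trace_on scale B (\<lambda>v. bracket y (bracket x (bracket z v)))
      = trace_on scale B (\<lambda>v. bracket x (bracket z (bracket y v)))"
    by (rule trace_on_comp_commute[OF finite_B independent_B linear_bracket, rotated])
      (simp_all add: span_B)
  then show ?thesis
    using span_B
    by (simp add: killing_def ad.act_commutator ad.act_diff_right trace_on_diff[OF independent_B])
qed

lemma killing_H:
  assumes "h \<in> H" "k \<in> H"
  shows "killing h k = (\<Sum>b\<in>B. wt b h * wt b k)"
  unfolding killing_def
  using root_spaceD[OF wt_root_space assms(1)] root_spaceD[OF wt_root_space assms(2)]
  by (intro trace_on_diagonal independent_B) (simp add: ad.act_linear mult.commute)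

lemma killing_root_spaces:
  assumes "x \<in> root_space H \<alpha>" "y \<in> root_space H \<beta>" "\<alpha> + \<beta> \<in> dual_space H" "\<alpha> + \<beta> \<noteq> 0"
  shows "killing x y = 0"
proof -
  obtain h where h: "h \<in> H" "(\<alpha> + \<beta>) h \<noteq> 0" using dual_space_nonzero[OF assms(3,4)] by blast
  have "\<alpha> h * killing x y = killing (bracket h x) y"
    using root_spaceD[OF assms(1) h(1)] by (simp add: killing_linear)
  also have "\<dots> = - killing (bracket x h) y"
    using bracket_commute[of h x] by (simp add: killing_minus)
  also have "\<dots> = - (\<beta> h * killing x y)"
    using root_spaceD[OF assms(2) h(1)] by (simp add: killing_invariant killing_linear)
  finally have "(\<alpha> + \<beta>) h * killing x y = 0" by (simp add: algebra_simps)
  then show ?thesis using h by simp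
qed

text \<open>On \<open>h = bracket x y\<close> all weights are real multiples of \<open>\<alpha>\<close>, so that \<open>killing h h\<close> is a sum of
  real squares times the square of \<open>\<alpha> h\<close>. If it vanishes, then all weights vanish at \<open>h\<close>.\<close>

lemma commutator_anisotropic:
  assumes "\<alpha> \<in> dual_space H" "x \<in> root_space H \<alpha>" "y \<in> root_space H (- \<alpha>)"
    and "killing (bracket x y) (bracket x y) = 0"
  shows "bracket x y = 0"
proof -
  let ?h = "bracket x y"
  have h: "?h \<in> H" using assms(2,3) by (rule bracket_opposite_in_H)
  obtain r :: "'a \<Rightarrow> real" where r: "\<And>b. b \<in> B \<Longrightarrow> wt b ?h = of_real (r b) * \<alpha> ?h"
    using weight_commutator_multiple[OF assms(1-3)] by metis
  have "(\<Sum>b\<in>B. wt b ?h * wt b ?h) = of_real (\<Sum>b\<in>B. (r b)\<^sup>2) * (\<alpha> ?h)\<^sup>2"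
    by (simp add: r sum_distrib_left power2_eq_square algebra_simps)
  then have "(\<Sum>b\<in>B. (r b)\<^sup>2) = 0 \<or> \<alpha> ?h = 0"
    using assms(4) killing_H[OF h h] by (metis mult_eq_0_iff of_real_eq_0_iff power_eq_0_iff)
  then have "wt b ?h = 0" if "b \<in> B" for b
    using r[OF that] that finite_B by (auto simp: sum_nonneg_eq_0_iff)
  then show ?thesis using h by (intro H_eqI) auto
qed

text \<open>The homogeneous elements of nonzero weight in the radical of the Killing form.\<close>

definition radical_vectors :: "'a set"
  where "radical_vectors =
    (\<Union>\<alpha>\<in>dual_space H - {0}. {x \<in> root_space H \<alpha>. \<forall>y. killing x y = 0})"

text \<open>The critical case is that of opposite weights. The bracket then lies in \<open>H\<close> and in the radical, so
  that it is isotropic and hence zero.\<close>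

lemma bracket_radical_vector:
  assumes "z \<in> radical_vectors" "x \<in> root_space H \<beta>" "\<beta> \<in> dual_space H"
  shows "bracket x z \<in> radical_vectors"
proof -
  obtain \<alpha> where \<alpha>: "\<alpha> \<in> dual_space H" "\<alpha> \<noteq> 0" "z \<in> root_space H \<alpha>" and z: "\<And>y. killing z y = 0"
    using assms(1) by (auto simp: radical_vectors_def)
  have k: "killing (bracket z x) y = 0" for y by (simp add: killing_invariant z)
  have rad: "killing (bracket x z) y = 0" for y
    using k[of y] bracket_commute[of x z] by (simp add: killing_minus)
  show ?thesis
  proof (cases "\<beta> + \<alpha> = 0")
    case True
    then have "\<beta> = - \<alpha>" by (simp add: eq_neg_iff_add_eq_0)
    then have "bracket z x = 0"
      using commutator_anisotropic[OF \<alpha>(1,3), of x] assms(2) k by simp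
    then have "bracket x z = 0" using bracket_commute[of x z] by simp
    then show ?thesis
      using \<alpha> subspace_0[OF subspace_root_space] by (auto simp: radical_vectors_def)
  next
    case False
    have "bracket x z \<in> root_space H (\<beta> + \<alpha>)" using assms(2) \<alpha>(3) by (rule bracket_root_space)
    moreover have "\<beta> + \<alpha> \<in> dual_space H" using assms(3) \<alpha>(1) by (rule dual_space_add)
    ultimately show ?thesis using False rad unfolding radical_vectors_def by blast
  qed
qed

text \<open>This is the part of Cartan's criterion that concerns nonzero weights. The radical vectors are
  closed under the bracket and each of them acts nilpotently, so that by the theorem of Engel and
  Jacobson they span an ideal that acts nilpotently.\<close>

lemma radical_vectors_trivial: "radical_vectors \<subseteq> {0}"
proof -
  have "\<exists>k. nil_level bracket radical_vectors k = UNIV"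
  proof (rule weakly_closed_nilpotent[OF finite_dimensional])
    show "bracket x y \<in> radical_vectors" if "x \<in> radical_vectors" "y \<in> radical_vectors" for x y
      using that(1) bracket_radical_vector[OF that(2)] unfolding radical_vectors_def by blast
    show "\<exists>m. nil_level bracket {z} m = UNIV" if z: "z \<in> radical_vectors" for z
    proof -
      obtain \<alpha> where "\<alpha> \<in> dual_space H" "\<alpha> \<noteq> 0" "z \<in> root_space H \<alpha>"
        using z by (auto simp: radical_vectors_def)
      then show ?thesis
        using ad.root_vector_nilpotent ad.finite_dim_stable[OF finite_dimensional]
          adjoint_weight_module ad.nilpotent_uniform[OF finite_dimensional] by metis
    qed
  qed
  then obtain k where "nil_level bracket (span radical_vectors) k = UNIV"
    using ad.nil_level_span by blast
  moreover have "lie_ideal (span radical_vectors)"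
    unfolding lie_ideal_def
  proof (intro conjI allI ballI)
    fix x y assume "y \<in> span radical_vectors"
    then show "bracket x y \<in> span radical_vectors"
      using bracket_radical_vector[OF _ wt_root_space wt_dual] span_base span_B
      by (intro bracket_span_span[of B radical_vectors radical_vectors x y]) auto
  qed simp
  ultimately have "span radical_vectors = {0}"
    using nilpotent_ideal_trivial[OF semisimple_algebra] by blast
  then show ?thesis using span_superset by blast
qed

text \<open>The components of nonzero weight of an element \<open>x\<close> of the radical are radical vectors and
  hence zero. For \<open>x\<close> in \<open>H\<close>, the identity \<open>killing x (bracket b y) = wt b x * killing b y\<close> then
  shows that every nonzero weight, and thus every weight, vanishes at \<open>x\<close>.\<close>

theorem killing_nondegenerate:
  assumes "\<And>c. c \<in> B \<Longrightarrow> killing x c = 0"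
  shows "x = 0"
proof -
  have rad: "killing x y = 0" for y
    by (subst coeff_expansion[of y, symmetric]) (simp add: killing_sum_right killing_linear assms)
  have zero: "coeff x b = 0" if b: "b \<in> B" "wt b \<noteq> 0" for b
  proof -
    let ?C = "{c \<in> B. wt c = wt b}"
    define x' where "x' = (\<Sum>c\<in>?C. scale (coeff x c) c)"
    have x': "x' \<in> root_space H (wt b)"
      unfolding x'_def using wt_root_space
      by (intro subspace_sum[OF subspace_root_space] subspace_scale[OF subspace_root_space]) fastforce
    have orth: "killing d c = 0" if "d \<in> B" "c \<in> B" "wt d + wt c \<noteq> 0" for c d
      using killing_root_spaces[OF wt_root_space[OF that(1)] wt_root_space[OF that(2)]]
        wt_dual that dual_space_add by blast
    have "killing x' c = 0" if c: "c \<in> B" for c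
    proof (cases "wt b + wt c = 0")
      case True
      have "killing x c = (\<Sum>d\<in>B. coeff x d * killing d c)"
        by (subst coeff_expansion[of x, symmetric]) (simp add: killing_sum_left killing_linear)
      also have "\<dots> = (\<Sum>d\<in>?C. coeff x d * killing d c)"
      proof (intro sum.mono_neutral_right ballI)
        fix d assume d: "d \<in> B - ?C"
        have "wt d + wt c = wt d - wt b" using True by (metis add_eq_0_iff diff_conv_add_uminus)
        then have "wt d + wt c \<noteq> 0" using d by auto
        then show "coeff x d * killing d c = 0" using orth c d by simp
      qed (auto simp: finite_B)
      also have "\<dots> = killing x' c" by (simp add: x'_def killing_sum_left killing_linear)
      finally show ?thesis using rad by simp
    next
      case False
      then show ?thesis
        using killing_root_spaces[OF x' wt_root_space[OF c]] wt_dual b c dual_space_add by blast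
    qed
    then have "killing x' y = 0" for y
      by (subst coeff_expansion[of y, symmetric]) (simp add: killing_sum_right killing_linear)
    then have "x' \<in> radical_vectors"
      using x' b wt_dual unfolding radical_vectors_def by blast
    then have "x' = 0" using radical_vectors_trivial by blast
    moreover have "finite ?C" "?C \<subseteq> B" using finite_B by auto
    ultimately show ?thesis
      using independentD[OF independent_B, of ?C "coeff x" b] b by (auto simp: x'_def)
  qed
  have "(\<Sum>b\<in>B. scale (coeff x b) b) \<in> H"
  proof (rule subspace_sum[OF subspace_H])
    fix b assume "b \<in> B"
    then show "scale (coeff x b) b \<in> H"
      using zero[of b] wt_eq_zero[of b] subspace_0[OF subspace_H] subspace_scale[OF subspace_H]
      by (cases "wt b = 0") auto
  qed
  then have "x \<in> H" by (simp add: coeff_expansion)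
  then show ?thesis
  proof (rule H_eqI)
    fix b assume b: "b \<in> B"
    show "wt b x = 0"
    proof (cases "wt b = 0")
      case False
      have "\<not> (\<forall>y. killing b y = 0)"
      proof
        assume "\<forall>y. killing b y = 0"
        then have "b \<in> radical_vectors"
          using b False wt_dual wt_root_space unfolding radical_vectors_def by blast
        then show False using radical_vectors_trivial B_nonzero[OF b] by blast
      qed
      then obtain y where y: "killing b y \<noteq> 0" by blast
      have "killing x (bracket b y) = killing (bracket x b) y" by (simp add: killing_invariant)
      also have "\<dots> = wt b x * killing b y"
        using root_spaceD[OF wt_root_space[OF b] \<open>x \<in> H\<close>] by (simp add: killing_linear)
      finally show ?thesis using rad y by simp
    qed simp
  qed
qed

end

section \<open>Dual bases and positivity\<close>

lemma sum_mult_delta: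
  fixes f :: "'a \<Rightarrow> 'b::semiring_1"
  assumes "finite A" "c \<in> A"
  shows "(\<Sum>a\<in>A. f a * (if a = c then 1 else 0)) = f c"
    "(\<Sum>a\<in>A. f a * (if c = a then 1 else 0)) = f c"
proof -
  have "(\<Sum>a\<in>A. f a * (if a = c then 1 else 0)) = (\<Sum>a\<in>A. if a = c then f a else 0)"
    by (intro sum.cong) auto
  then show "(\<Sum>a\<in>A. f a * (if a = c then 1 else 0)) = f c" using assms by simp
  then show "(\<Sum>a\<in>A. f a * (if c = a then 1 else 0)) = f c" by (simp add: eq_commute[of c])
qed

context weight_basis
begin

lemma killing_eqI:
  assumes "\<And>c. c \<in> B \<Longrightarrow> killing x c = killing y c"
  shows "x = y"
proof -
  have "killing (x - y) c = 0" if "c \<in> B" for c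
    using assms[OF that] killing_linear(1)[of x "- y" c] by (simp add: killing_minus)
  then have "x - y = 0" by (rule killing_nondegenerate)
  then show ?thesis by simp
qed

text \<open>The basis dual to \<open>B\<close> with respect to the Killing form.\<close>

definition dual_vec :: "'a \<Rightarrow> 'a"
  where "dual_vec b = (SOME d. \<forall>c\<in>B. killing d c = (if c = b then 1 else 0))"

lemma killing_dual_vec:
  assumes "b \<in> B" "c \<in> B"
  shows "killing (dual_vec b) c = (if c = b then 1 else 0)"
proof -
  interpret fd: finite_dimensional_vector_space scale B
    by unfold_locales (fact finite_B independent_B span_B)+
  let ?f = "\<lambda>x. \<Sum>c\<in>B. scale (killing x c) c"
  have lin: "Vector_Spaces.linear scale scale ?f"
    by unfold_locales
      (simp_all add: killing_linear scale_left_distrib sum.distrib scale_sum_right)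
  have coords: "killing x c = u c" if "?f x = (\<Sum>c\<in>B. scale (u c) c)" "c \<in> B" for x u c
  proof -
    have "(\<Sum>c\<in>B. scale (killing x c - u c) c) = 0"
      using that(1) by (simp add: scale_left_diff_distrib sum_subtractf)
    then have "killing x c - u c = 0"
      by (rule independentD[OF independent_B finite_B subset_refl _ that(2)])
    then show ?thesis by simp
  qed
  have "inj ?f"
  proof (rule injI)
    fix x y assume "?f x = ?f y"
    then show "x = y" using coords[of x "killing y"] by (intro killing_eqI) simp
  qed
  then have "surj ?f" using fd.linear_inj_imp_surj[OF lin] by simp
  then obtain d where d: "b = ?f d" by (rule surjE)
  have "(\<Sum>c\<in>B. scale (if c = b then 1 else 0) c) = b"
    using assms(1) finite_B by (simp add: sum.remove[of B b])
  then have "?f d = (\<Sum>c\<in>B. scale (if c = b then 1 else 0) c)" using d by metis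
  then have "\<forall>c\<in>B. killing d c = (if c = b then 1 else 0)"
    using coords[of d "\<lambda>c. if c = b then 1 else 0"] by blast
  then have "\<forall>c\<in>B. killing (dual_vec b) c = (if c = b then 1 else 0)"
    unfolding dual_vec_def by (rule someI)
  then show ?thesis using assms by simp
qed

lemma dual_vec_root_space:
  assumes b: "b \<in> B"
  shows "dual_vec b \<in> root_space H (- wt b)"
proof -
  have "bracket h (dual_vec b) = scale (- wt b h) (dual_vec b)" if h: "h \<in> H" for h
  proof (rule killing_eqI)
    fix c assume c: "c \<in> B"
    have "killing (bracket h (dual_vec b)) c = - killing (dual_vec b) (bracket h c)"
      using bracket_commute[of h "dual_vec b"] by (simp add: killing_minus killing_invariant)
    also have "\<dots> = killing (scale (- wt b h) (dual_vec b)) c"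
      using root_spaceD[OF wt_root_space[OF c] h] killing_dual_vec[OF b c]
      by (simp add: killing_linear killing_minus)
    finally show "killing (bracket h (dual_vec b)) c = killing (scale (- wt b h) (dual_vec b)) c" .
  qed
  then show ?thesis by (auto simp: root_space_def weight_space_def)
qed

lemma expansion_B: "(\<Sum>c\<in>B. scale (killing y (dual_vec c)) c) = y"
proof -
  have "killing y (dual_vec c) = coeff y c" if c: "c \<in> B" for c
  proof -
    have "killing y (dual_vec c) = (\<Sum>b\<in>B. coeff y b * killing (dual_vec c) b)"
      by (subst coeff_expansion[of y, symmetric])
        (simp only: killing_sym[of _ "dual_vec c"] killing_sum_right killing_linear)
    also have "\<dots> = coeff y c"
      using c finite_B by (simp add: killing_dual_vec sum_mult_delta)
    finally show ?thesis .
  qed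
  then show ?thesis using coeff_expansion[of y] by simp
qed

lemma expansion_dual_vec: "(\<Sum>c\<in>B. scale (killing y c) (dual_vec c)) = y"
proof (rule killing_eqI)
  fix c assume "c \<in> B"
  then show "killing (\<Sum>c\<in>B. scale (killing y c) (dual_vec c)) c = killing y c"
    using finite_B by (simp add: killing_sum_left killing_linear killing_dual_vec sum_mult_delta)
qed

text \<open>The element of \<open>H\<close> that represents a functional with respect to the Killing form.\<close>

definition dual_elt :: "('a \<Rightarrow> complex) \<Rightarrow> 'a"
  where "dual_elt \<gamma> = (\<Sum>b | b \<in> B \<and> wt b = 0. scale (\<gamma> b) (dual_vec b))"

lemma dual_vec_in_H: "b \<in> B \<Longrightarrow> wt b = 0 \<Longrightarrow> dual_vec b \<in> H"
  using dual_vec_root_space[of b] root_space_zero by simp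

lemma dual_elt_in_H: "dual_elt \<gamma> \<in> H"
  unfolding dual_elt_def using dual_vec_in_H
  by (intro subspace_sum[OF subspace_H] subspace_scale[OF subspace_H]) auto

lemma killing_dual_elt:
  assumes "\<gamma> \<in> dual_space H" "h \<in> H"
  shows "killing (dual_elt \<gamma>) h = \<gamma> h"
proof -
  let ?B0 = "{b \<in> B. wt b = 0}"
  have "coeff h b = 0" if "b \<in> B" "wt b \<noteq> 0" for b
    using coeff_weight[of h 0 b] assms(2) that dual_space_zero root_space_zero by auto
  then have "(\<Sum>b\<in>?B0. scale (coeff h b) b) = (\<Sum>b\<in>B. scale (coeff h b) b)"
    using finite_B by (intro sum.mono_neutral_left) auto
  then have h: "(\<Sum>b\<in>?B0. scale (coeff h b) b) = h" by (simp add: coeff_expansion)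
  have "killing (dual_elt \<gamma>) b = \<gamma> b" if "b \<in> ?B0" for b
    using that finite_B unfolding dual_elt_def
    by (simp add: killing_sum_left killing_linear killing_dual_vec sum_mult_delta)
  then have "killing (dual_elt \<gamma>) (\<Sum>b\<in>?B0. scale (coeff h b) b) = (\<Sum>b\<in>?B0. coeff h b * \<gamma> b)"
    by (simp add: killing_sum_right killing_linear)
  also have "\<dots> = \<gamma> (\<Sum>b\<in>?B0. scale (coeff h b) b)"
    using wt_eq_zero subspace_scale[OF subspace_H]
    by (subst dual_space_sum[OF assms(1)]) (auto simp: dual_space_D(2)[OF assms(1)])
  finally show ?thesis by (simp add: h)
qed

lemma dual_elt_sym:
  "\<gamma> \<in> dual_space H \<Longrightarrow> \<delta> \<in> dual_space H \<Longrightarrow> \<gamma> (dual_elt \<delta>) = \<delta> (dual_elt \<gamma>)"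
  using killing_dual_elt[OF _ dual_elt_in_H] killing_sym by metis

lemma commutator_dual_elt:
  assumes "\<alpha> \<in> dual_space H" "x \<in> root_space H \<alpha>" "y \<in> root_space H (- \<alpha>)"
  shows "bracket x y = scale (killing x y) (dual_elt \<alpha>)"
proof (rule killing_eqI)
  let ?z = "scale (killing x y) (dual_elt \<alpha>)"
  have in_H: "bracket x y \<in> H" "?z \<in> H"
    using bracket_opposite_in_H[OF assms(2,3)] dual_elt_in_H subspace_scale[OF subspace_H] by auto
  fix c assume c: "c \<in> B"
  show "killing (bracket x y) c = killing ?z c"
  proof (cases "wt c = 0")
    case True
    have "killing (bracket x y) c = - killing x (bracket c y)"
      using bracket_commute[of y c] by (simp add: killing_invariant killing_minus)
    also have "\<dots> = killing ?z c"
      using root_spaceD[OF assms(3) wt_eq_zero[OF c True]]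
        killing_dual_elt[OF assms(1) wt_eq_zero[OF c True]]
      by (simp add: killing_linear killing_minus)
    finally show ?thesis .
  next
    case False
    then have "killing h c = 0" if "h \<in> H" for h
      using killing_root_spaces[of h 0 c "wt c"] that wt_root_space[OF c] wt_dual[OF c]
        root_space_zero by simp
    then show ?thesis using in_H by simp
  qed
qed

lemma roots_D:
  assumes "\<alpha> \<in> roots H"
  shows "\<alpha> \<in> dual_space H" "\<alpha> \<noteq> 0"
  using assms by (auto simp: roots_def)

lemma dual_elt_nonzero:
  assumes "\<gamma> \<in> dual_space H" "\<gamma> \<noteq> 0"
  shows "dual_elt \<gamma> \<noteq> 0"
proof
  assume "dual_elt \<gamma> = 0"
  moreover obtain h where "h \<in> H" "\<gamma> h \<noteq> 0" using dual_space_nonzero[OF assms] by blast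
  ultimately show False using killing_dual_elt[OF assms(1), of h] by simp
qed

lemma opposite_root_vector:
  assumes "\<alpha> \<in> dual_space H" "x \<in> root_space H \<alpha>" "x \<noteq> 0"
  shows "\<exists>y\<in>root_space H (- \<alpha>). bracket x y = dual_elt \<alpha>"
proof -
  obtain c where c: "c \<in> B" "killing x c \<noteq> 0" using killing_nondegenerate assms(3) by blast
  then have "\<alpha> + wt c = 0"
    using killing_root_spaces[OF assms(2) wt_root_space] dual_space_add[OF assms(1)] wt_dual
    by blast
  then have "c \<in> root_space H (- \<alpha>)"
    using wt_root_space[OF c(1)] by (metis add_eq_0_iff)
  then have y: "scale (inverse (killing x c)) c \<in> root_space H (- \<alpha>)"
    using subspace_root_space subspace_scale by blast
  moreover have "bracket x (scale (inverse (killing x c)) c) = dual_elt \<alpha>"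
    using commutator_dual_elt[OF assms(1,2) y] c(2) by (simp add: killing_linear)
  ultimately show ?thesis by blast
qed

text \<open>The element \<open>dual_elt \<alpha>\<close> is a bracket of opposite root vectors, on which all weights are real
  multiples \<open>r b\<close> of \<open>a = \<alpha> (dual_elt \<alpha>)\<close>. The formula for the Killing form on \<open>H\<close> gives
  \<open>a = a\<^sup>2 * (\<Sum>b\<in>B. (r b)\<^sup>2)\<close>, so that \<open>a\<close> is real and positive.\<close>

lemma root_pairings_real:
  assumes "\<alpha> \<in> roots H"
  shows "\<exists>r::real. 0 < r \<and> \<alpha> (dual_elt \<alpha>) = of_real r"
    and "b \<in> B \<Longrightarrow> \<exists>r::real. wt b (dual_elt \<alpha>) = of_real r"
proof -
  note \<alpha> = roots_D[OF assms]
  have "0 \<in> root_space H \<alpha>" using subspace_0[OF subspace_root_space] .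
  then obtain x where x: "x \<in> root_space H \<alpha>" "x \<noteq> 0" using assms by (auto simp: roots_def)
  then obtain y where y: "y \<in> root_space H (- \<alpha>)" and t: "bracket x y = dual_elt \<alpha>"
    using opposite_root_vector[OF \<alpha>(1)] by blast
  obtain r :: "'a \<Rightarrow> real" where r: "\<And>b. b \<in> B \<Longrightarrow> wt b (dual_elt \<alpha>) = of_real (r b) * \<alpha> (dual_elt \<alpha>)"
    using weight_commutator_multiple[OF \<alpha>(1) x(1) y] t by metis
  let ?S = "\<Sum>b\<in>B. (r b)\<^sup>2" and ?a = "\<alpha> (dual_elt \<alpha>)"
  have a: "?a = killing (dual_elt \<alpha>) (dual_elt \<alpha>)"
    by (rule killing_dual_elt[OF \<alpha>(1) dual_elt_in_H, symmetric])
  then have "?a \<noteq> 0"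
    using commutator_anisotropic[OF \<alpha>(1) x(1) y] t dual_elt_nonzero[OF \<alpha>] by auto
  have "?a = (\<Sum>b\<in>B. wt b (dual_elt \<alpha>) * wt b (dual_elt \<alpha>))"
    using a killing_H[OF dual_elt_in_H dual_elt_in_H] by simp
  also have "\<dots> = of_real ?S * ?a * ?a"
    by (simp add: r sum_distrib_left power2_eq_square algebra_simps)
  finally have S: "of_real ?S * ?a = 1" using \<open>?a \<noteq> 0\<close> by simp
  then have "?S \<noteq> 0" by (metis mult_zero_left of_real_0 zero_neq_one)
  then have "0 < ?S" using sum_nonneg[of B "\<lambda>b. (r b)\<^sup>2"] by simp
  have "?a = of_real (1 / ?S)"
    using S \<open>?S \<noteq> 0\<close> by (simp add: field_simps del: of_real_sum)
  then show "\<exists>r::real. 0 < r \<and> \<alpha> (dual_elt \<alpha>) = of_real r"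
    using \<open>0 < ?S\<close> by (intro exI[of _ "1 / ?S"]) simp
  then show "\<exists>r::real. wt b (dual_elt \<alpha>) = of_real r" if "b \<in> B"
    using r[OF that] by (metis of_real_mult)
qed

end

locale based_weight_basis = weight_basis scale bracket H B wt
  for scale :: "complex \<Rightarrow> 'g::ab_group_add \<Rightarrow> 'g" and bracket H B wt +
  fixes \<Delta> :: "('g \<Rightarrow> complex) set"
  assumes base: "root_base H \<Delta>"
begin

lemma finite_base: "finite \<Delta>"
  and base_roots: "\<Delta> \<subseteq> roots H"
  using base by (auto simp: root_base_def)

definition comb :: "(('g \<Rightarrow> complex) \<Rightarrow> real) \<Rightarrow> 'g \<Rightarrow> complex"
  where "comb u = (\<lambda>x. \<Sum>\<alpha>\<in>\<Delta>. of_real (u \<alpha>) * \<alpha> x)"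

lemma comb_add: "comb u + comb v = comb (\<lambda>\<alpha>. u \<alpha> + v \<alpha>)"
  and comb_minus: "- comb u = comb (\<lambda>\<alpha>. - u \<alpha>)"
  and comb_diff: "comb u - comb v = comb (\<lambda>\<alpha>. u \<alpha> - v \<alpha>)"
  by (auto simp: comb_def fun_eq_iff algebra_simps sum.distrib sum_negf sum_subtractf)

lemma comb_zero: "comb (\<lambda>_. 0) = 0"
  by (auto simp: comb_def fun_eq_iff)

lemma comb_single: "\<alpha> \<in> \<Delta> \<Longrightarrow> comb (\<lambda>\<beta>. if \<beta> = \<alpha> then 1 else 0) = \<alpha>"
proof
  fix x assume "\<alpha> \<in> \<Delta>"
  have "comb (\<lambda>\<beta>. if \<beta> = \<alpha> then 1 else 0) x = (\<Sum>\<beta>\<in>\<Delta>. if \<beta> = \<alpha> then \<beta> x else 0)"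
    unfolding comb_def by (intro sum.cong) auto
  also have "\<dots> = \<alpha> x" using finite_base \<open>\<alpha> \<in> \<Delta>\<close> by simp
  finally show "comb (\<lambda>\<beta>. if \<beta> = \<alpha> then 1 else 0) x = \<alpha> x" .
qed

lemma comb_eqD:
  assumes "comb u = comb v" "\<alpha> \<in> \<Delta>"
  shows "u \<alpha> = v \<alpha>"
proof -
  interpret F: vector_space "\<lambda>(r::real) (f::'g \<Rightarrow> complex) x. of_real r * f x"
    by unfold_locales (auto simp: fun_eq_iff algebra_simps)
  have sum_apply: "sum f A x = (\<Sum>a\<in>A. f a x)" for f :: "('g \<Rightarrow> complex) \<Rightarrow> 'g \<Rightarrow> complex" and A x
    by (induction A rule: infinite_finite_induct) auto
  have "(\<Sum>\<alpha>\<in>\<Delta>. of_real (u \<alpha> - v \<alpha>) * \<alpha> x) = 0" for x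
    using fun_cong[OF assms(1), of x] by (simp add: comb_def algebra_simps sum_subtractf)
  then have "(\<Sum>\<alpha>\<in>\<Delta>. (\<lambda>x. of_real (u \<alpha> - v \<alpha>) * \<alpha> x)) = 0"
    by (simp add: fun_eq_iff sum_apply)
  then have "u \<alpha> - v \<alpha> = 0"
    using base assms(2)
    by (intro F.independentD[of \<Delta> \<Delta> "\<lambda>\<alpha>. u \<alpha> - v \<alpha>" \<alpha>]) (auto simp: root_base_def)
  then show ?thesis by simp
qed

text \<open>Real coefficients are allowed because the estimates below depend only on the signs of the
  coefficients.\<close>

definition positive_cone :: "('g \<Rightarrow> complex) set"
  where "positive_cone = {comb u |u. \<forall>\<alpha>\<in>\<Delta>. 0 \<le> u \<alpha>} - {0}"

lemma positive_coneE:
  assumes "\<nu> \<in> positive_cone"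
  obtains u where "\<nu> = comb u" "\<And>\<alpha>. \<alpha> \<in> \<Delta> \<Longrightarrow> 0 \<le> u \<alpha>"
  using assms by (auto simp: positive_cone_def)

lemma comb_nonneg_eq_zero:
  assumes "comb u = 0" "\<alpha> \<in> \<Delta>" shows "u \<alpha> = 0"
  using comb_eqD[of u "\<lambda>_. 0"] assms by (simp add: comb_zero)

lemma zero_notin_positive_cone: "0 \<notin> positive_cone"
  by (simp add: positive_cone_def)

lemma comb_eq_0I: "(\<And>\<alpha>. \<alpha> \<in> \<Delta> \<Longrightarrow> u \<alpha> = 0) \<Longrightarrow> comb u = 0"
  by (auto simp: comb_def fun_eq_iff)

lemma positive_cone_add:
  assumes "\<mu> \<in> positive_cone" "\<nu> \<in> positive_cone"
  shows "\<mu> + \<nu> \<in> positive_cone"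
proof -
  obtain u where u: "\<mu> = comb u" "\<And>\<alpha>. \<alpha> \<in> \<Delta> \<Longrightarrow> 0 \<le> u \<alpha>" using assms(1) by (rule positive_coneE) blast
  obtain v where v: "\<nu> = comb v" "\<And>\<alpha>. \<alpha> \<in> \<Delta> \<Longrightarrow> 0 \<le> v \<alpha>" using assms(2) by (rule positive_coneE) blast
  have eq: "\<mu> + \<nu> = comb (\<lambda>\<alpha>. u \<alpha> + v \<alpha>)" using u v by (simp add: comb_add)
  have "\<mu> + \<nu> \<noteq> 0"
  proof
    assume "\<mu> + \<nu> = 0"
    then have "u \<alpha> + v \<alpha> = 0" if "\<alpha> \<in> \<Delta>" for \<alpha> using comb_nonneg_eq_zero[OF _ that] eq by auto
    then have "u \<alpha> = 0" if "\<alpha> \<in> \<Delta>" for \<alpha> using u(2)[OF that] v(2)[OF that] that by fastforce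
    then have "\<mu> = 0" using u(1) comb_eq_0I by auto
    then show False using assms(1) zero_notin_positive_cone by simp
  qed
  moreover have "\<forall>\<alpha>\<in>\<Delta>. 0 \<le> u \<alpha> + v \<alpha>" using u(2) v(2) by simp
  ultimately show ?thesis unfolding positive_cone_def eq by blast
qed

lemma positive_cone_uminus: "\<nu> \<in> positive_cone \<Longrightarrow> - \<nu> \<notin> positive_cone"
  using positive_cone_add[of \<nu> "- \<nu>"] zero_notin_positive_cone by auto

lemma positive_cone_dual_space: "positive_cone \<subseteq> dual_space H"
proof
  fix \<nu> assume "\<nu> \<in> positive_cone"
  then obtain u where u: "\<nu> = comb u" by (rule positive_coneE)
  have "\<alpha> \<in> dual_space H" if "\<alpha> \<in> \<Delta>" for \<alpha> using that base_roots roots_D by blast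
  then have add: "\<alpha> (x + y) = \<alpha> x + \<alpha> y" and scl: "\<alpha> (scale c x) = c * \<alpha> x"
    if "\<alpha> \<in> \<Delta>" "x \<in> H" "y \<in> H" for \<alpha> x y c
    using that by (auto simp: dual_space_def)
  have off: "\<alpha> z = 0" if "\<alpha> \<in> \<Delta>" "z \<notin> H" for \<alpha> z
    using that base_roots roots_D(1) by (fastforce simp: dual_space_def)
  have "comb u (x + y) = comb u x + comb u y" if "x \<in> H" "y \<in> H" for x y
    unfolding comb_def sum.distrib[symmetric]
    by (rule sum.cong) (simp_all add: add[OF _ that] flip: distrib_left)
  moreover have "comb u (scale c x) = c * comb u x" if "x \<in> H" for c x
    unfolding comb_def sum_distrib_left
    by (rule sum.cong) (simp_all add: scl[OF _ that that])
  moreover have "comb u z = 0" if "z \<notin> H" for z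
    unfolding comb_def using off that by (intro sum.neutral) auto
  ultimately show "\<nu> \<in> dual_space H" unfolding u dual_space_def by blast
qed

lemma nat_combinations_comb:
  assumes "\<beta> \<in> nat_combinations \<Delta>" "\<beta> \<noteq> 0"
  shows "\<beta> \<in> positive_cone"
proof -
  obtain c :: "_ \<Rightarrow> nat" where "\<beta> = (\<lambda>x. \<Sum>\<alpha>\<in>\<Delta>. of_nat (c \<alpha>) * \<alpha> x)"
    using assms(1) by (auto simp: nat_combinations_def)
  then have "\<beta> = comb (\<lambda>\<alpha>. real (c \<alpha>))" by (simp add: comb_def)
  then show ?thesis using assms(2) by (auto simp: positive_cone_def)
qed

lemma roots_cone:
  assumes "\<beta> \<in> roots H"
  shows "\<beta> \<in> positive_cone \<or> - \<beta> \<in> positive_cone"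
  using assms base roots_D[OF assms] nat_combinations_comb[of \<beta>] nat_combinations_comb[of "- \<beta>"]
  by (auto simp: root_base_def)

lemma positive_roots_eq: "positive_roots H \<Delta> = roots H \<inter> positive_cone"
proof -
  have "\<beta> \<in> nat_combinations \<Delta>" if "\<beta> \<in> roots H" "\<beta> \<in> positive_cone" for \<beta>
    using that base nat_combinations_comb[of "- \<beta>"] roots_D[OF that(1)] positive_cone_uminus[of \<beta>]
    by (auto simp: root_base_def)
  then show ?thesis using nat_combinations_comb roots_D by (auto simp: positive_roots_def)
qed

lemma nonzero_root_vector_root:
  "\<alpha> \<in> dual_space H \<Longrightarrow> \<alpha> \<noteq> 0 \<Longrightarrow> x \<in> root_space H \<alpha> \<Longrightarrow> x \<noteq> 0 \<Longrightarrow> \<alpha> \<in> roots H"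
  by (auto simp: roots_def)

lemma wt_cases:
  assumes "b \<in> B"
  shows "wt b = 0 \<or> wt b \<in> positive_cone \<or> - wt b \<in> positive_cone"
  using nonzero_root_vector_root[OF wt_dual _ wt_root_space B_nonzero] roots_cone assms by blast

lemma wt_comb:
  assumes "b \<in> B"
  shows "\<exists>u. wt b = comb u \<and> ((\<forall>\<alpha>\<in>\<Delta>. 0 \<le> u \<alpha>) \<or> (\<forall>\<alpha>\<in>\<Delta>. u \<alpha> \<le> 0))"
  using wt_cases[OF assms]
proof (elim disjE)
  assume "wt b = 0"
  then show ?thesis by (intro exI[of _ "\<lambda>_. 0"]) (simp add: comb_zero)
next
  assume "wt b \<in> positive_cone"
  then show ?thesis by (metis positive_coneE)
next
  assume "- wt b \<in> positive_cone"
  then obtain u where u: "- wt b = comb u" "\<And>\<alpha>. \<alpha> \<in> \<Delta> \<Longrightarrow> 0 \<le> u \<alpha>" by (rule positive_coneE) blast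
  then have "wt b = comb (\<lambda>\<alpha>. - u \<alpha>)" using comb_minus[of u] by (metis minus_minus)
  then show ?thesis using u(2) by (intro exI[of _ "\<lambda>\<alpha>. - u \<alpha>"]) auto
qed

text \<open>The basis vectors in the sum of the root spaces of the negative roots.\<close>

definition negative_part :: "'g set"
  where "negative_part = {b \<in> B. - wt b \<in> positive_cone}"

text \<open>This says that the half sum \<open>\<rho>\<close> of the positive roots is dominant. The negative weights that
  are not multiples of the simple root \<open>\<alpha>\<close> contribute the trace of a commutator of root vectors of
  weights \<open>\<alpha>\<close> and \<open>- \<alpha>\<close>, which is zero: adding or subtracting \<open>\<alpha>\<close> does not change their
  negative coefficient at another simple root, so that they remain negative. The multiples of \<open>\<alpha>\<close>
  contribute nonpositive multiples of its square length.\<close>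

lemma negative_trace_simple:
  assumes \<alpha>: "\<alpha> \<in> \<Delta>"
  shows "\<exists>s::real. s \<le> 0 \<and> (\<Sum>b\<in>negative_part. wt b (dual_elt \<alpha>)) = of_real s"
proof -
  have root: "\<alpha> \<in> roots H" using \<alpha> base_roots by blast
  note \<alpha>_dual = roots_D(1)[OF root]
  obtain r where r: "0 < r" "\<alpha> (dual_elt \<alpha>) = of_real r"
    using root_pairings_real(1)[OF root] by blast
  define C where "C = {b \<in> B. \<exists>u. wt b = comb u \<and> (\<forall>\<gamma>\<in>\<Delta>. u \<gamma> \<le> 0) \<and> (\<exists>\<gamma>\<in>\<Delta>. \<gamma> \<noteq> \<alpha> \<and> u \<gamma> < 0)}"
  have "0 \<in> root_space H \<alpha>" using subspace_0[OF subspace_root_space] .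
  then obtain x where x: "x \<in> root_space H \<alpha>" "x \<noteq> 0" using root by (auto simp: roots_def)
  then obtain y where y: "y \<in> root_space H (- \<alpha>)" and t: "bracket x y = dual_elt \<alpha>"
    using opposite_root_vector[OF \<alpha>_dual] by blast
  have zero: "(\<Sum>b\<in>C. wt b (dual_elt \<alpha>)) = 0"
    unfolding t[symmetric]
  proof (rule sum_weights_commutator[OF \<alpha>_dual x(1) y])
    show "C \<subseteq> B" by (auto simp: C_def)
    fix b c assume b: "b \<in> C" and c: "c \<in> B" "wt c = wt b + \<alpha> \<or> wt c = wt b - \<alpha>"
    obtain u \<gamma> where u: "wt b = comb u" and \<gamma>: "\<gamma> \<in> \<Delta>" "\<gamma> \<noteq> \<alpha>" "u \<gamma> < 0"
      using b by (auto simp: C_def)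
    define e :: "('g \<Rightarrow> complex) \<Rightarrow> real" where "e \<beta> = (if \<beta> = \<alpha> then 1 else 0)" for \<beta>
    have "wt c = comb (\<lambda>\<beta>. u \<beta> + e \<beta>) \<or> wt c = comb (\<lambda>\<beta>. u \<beta> - e \<beta>)"
      using c(2) comb_single[OF \<alpha>] comb_add[of u e] comb_diff[of u e] u
      by (auto simp: e_def[abs_def])
    moreover obtain v where v: "wt c = comb v" "(\<forall>\<beta>\<in>\<Delta>. 0 \<le> v \<beta>) \<or> (\<forall>\<beta>\<in>\<Delta>. v \<beta> \<le> 0)"
      using wt_comb[OF c(1)] by blast
    ultimately have "v \<gamma> = u \<gamma> + e \<gamma> \<or> v \<gamma> = u \<gamma> - e \<gamma>"
      using comb_eqD[OF _ \<gamma>(1)] by metis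
    then have "v \<gamma> < 0" using \<gamma> by (simp add: e_def)
    then show "c \<in> C" using v \<gamma> c(1) unfolding C_def by force
  qed
  have C_sub: "C \<subseteq> negative_part"
  proof
    fix b assume "b \<in> C"
    then obtain u \<gamma> where b: "b \<in> B" and u: "wt b = comb u" "\<forall>\<gamma>\<in>\<Delta>. u \<gamma> \<le> 0"
      and \<gamma>: "\<gamma> \<in> \<Delta>" "u \<gamma> < 0" by (auto simp: C_def)
    have "- wt b = comb (\<lambda>\<alpha>. - u \<alpha>)" using u comb_minus by simp
    moreover have "wt b \<noteq> 0" using comb_nonneg_eq_zero[OF _ \<gamma>(1), of u] u \<gamma>(2) by auto
    ultimately show "b \<in> negative_part"
      using b u(2) by (auto simp: negative_part_def positive_cone_def)
  qed
  have "\<exists>s::real. s \<le> 0 \<and> wt b (dual_elt \<alpha>) = of_real s" if b: "b \<in> negative_part - C" for b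
  proof -
    have bB: "b \<in> B" using b by (simp add: negative_part_def)
    have "- wt b \<in> positive_cone" using b by (simp add: negative_part_def)
    then obtain u where u: "- wt b = comb u" "\<And>\<gamma>. \<gamma> \<in> \<Delta> \<Longrightarrow> 0 \<le> u \<gamma>" by (rule positive_coneE) blast
    have wt: "wt b = comb (\<lambda>\<gamma>. - u \<gamma>)" using u(1) comb_minus[of u] by (metis minus_minus)
    have zero': "u \<gamma> = 0" if "\<gamma> \<in> \<Delta>" "\<gamma> \<noteq> \<alpha>" for \<gamma>
    proof (rule ccontr)
      assume "u \<gamma> \<noteq> 0"
      then have "- u \<gamma> < 0" using u(2)[OF that(1)] by simp
      then have "b \<in> C"
        using bB wt u(2) that unfolding C_def
        by (auto intro!: exI[of _ "\<lambda>\<gamma>. - u \<gamma>"] bexI[of _ \<gamma>])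
      then show False using b by simp
    qed
    have "wt b (dual_elt \<alpha>) = of_real (- u \<alpha>) * \<alpha> (dual_elt \<alpha>)"
      unfolding wt comb_def using finite_base \<alpha> zero' by (simp add: sum.remove)
    then have "wt b (dual_elt \<alpha>) = of_real (- u \<alpha> * r)" using r by simp
    moreover have "- u \<alpha> * r \<le> 0" using u(2)[OF \<alpha>] r(1) by simp
    ultimately show ?thesis by blast
  qed
  then obtain s :: "'g \<Rightarrow> real"
    where s: "\<And>b. b \<in> negative_part - C \<Longrightarrow> s b \<le> 0 \<and> wt b (dual_elt \<alpha>) = of_real (s b)"
    by metis
  have "(\<Sum>b\<in>negative_part. wt b (dual_elt \<alpha>)) = (\<Sum>b\<in>negative_part - C. wt b (dual_elt \<alpha>))"
    using C_sub zero finite_B by (subst sum.subset_diff[of C]) (auto simp: negative_part_def)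
  also have "\<dots> = of_real (\<Sum>b\<in>negative_part - C. s b)" using s by simp
  finally show ?thesis using s by (intro exI[of _ "\<Sum>b\<in>negative_part - C. s b"]) (auto intro: sum_nonpos)
qed

text \<open>The scalar by which the Casimir operator acts on a highest weight vector of weight \<open>\<nu>\<close>, that
  is, the square length of \<open>\<nu> + \<rho>\<close> minus that of \<open>\<rho>\<close>.\<close>

definition casimir_scalar :: "('g \<Rightarrow> complex) \<Rightarrow> complex"
  where "casimir_scalar \<nu> = \<nu> (dual_elt \<nu>) - (\<Sum>b\<in>negative_part. wt b (dual_elt \<nu>))"

text \<open>The square length of \<open>\<nu>\<close> is positive since its pairings with the weights are real and not all
  zero, and the other term has the right sign since \<open>\<rho>\<close> is dominant.\<close>

lemma casimir_scalar_nonzero: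
  assumes "\<nu> \<in> positive_cone"
  shows "casimir_scalar \<nu> \<noteq> 0"
proof -
  have \<nu>: "\<nu> \<in> dual_space H" "\<nu> \<noteq> 0"
    using assms positive_cone_dual_space zero_notin_positive_cone by auto
  obtain u where u: "\<nu> = comb u" "\<And>\<alpha>. \<alpha> \<in> \<Delta> \<Longrightarrow> 0 \<le> u \<alpha>"
    using assms by (rule positive_coneE) blast
  have \<Delta>: "\<alpha> \<in> roots H" "\<alpha> \<in> dual_space H" if "\<alpha> \<in> \<Delta>" for \<alpha>
    using that base_roots roots_D by blast+
  have wt_\<nu>: "wt b (dual_elt \<nu>) = (\<Sum>\<alpha>\<in>\<Delta>. of_real (u \<alpha>) * wt b (dual_elt \<alpha>))" if b: "b \<in> B" for b
  proof -
    have "wt b (dual_elt \<nu>) = comb u (dual_elt (wt b))"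
      using dual_elt_sym[OF wt_dual[OF b] \<nu>(1)] u(1) by simp
    also have "\<dots> = (\<Sum>\<alpha>\<in>\<Delta>. of_real (u \<alpha>) * wt b (dual_elt \<alpha>))"
      unfolding comb_def using dual_elt_sym[OF \<Delta>(2) wt_dual[OF b]] by (intro sum.cong) auto
    finally show ?thesis .
  qed
  have "\<exists>r::real. wt b (dual_elt \<nu>) = of_real r" if b: "b \<in> B" for b
  proof -
    obtain r :: "('g \<Rightarrow> complex) \<Rightarrow> real" where "\<And>\<alpha>. \<alpha> \<in> \<Delta> \<Longrightarrow> wt b (dual_elt \<alpha>) = of_real (r \<alpha>)"
      using root_pairings_real(2)[OF \<Delta>(1) b] by metis
    then have "wt b (dual_elt \<nu>) = of_real (\<Sum>\<alpha>\<in>\<Delta>. u \<alpha> * r \<alpha>)" using wt_\<nu>[OF b] by simp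
    then show ?thesis by blast
  qed
  then obtain r :: "'g \<Rightarrow> real" where r: "\<And>b. b \<in> B \<Longrightarrow> wt b (dual_elt \<nu>) = of_real (r b)"
    by metis
  have "\<nu> (dual_elt \<nu>) = killing (dual_elt \<nu>) (dual_elt \<nu>)"
    by (rule killing_dual_elt[OF \<nu>(1) dual_elt_in_H, symmetric])
  also have "\<dots> = of_real (\<Sum>b\<in>B. (r b)\<^sup>2)"
    using killing_H[OF dual_elt_in_H dual_elt_in_H] r by (simp add: power2_eq_square)
  finally have norm: "\<nu> (dual_elt \<nu>) = of_real (\<Sum>b\<in>B. (r b)\<^sup>2)" .
  have "(\<Sum>b\<in>B. (r b)\<^sup>2) \<noteq> 0"
  proof
    assume "(\<Sum>b\<in>B. (r b)\<^sup>2) = 0"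
    then have "wt b (dual_elt \<nu>) = 0" if "b \<in> B" for b
      using r[OF that] that finite_B by (auto simp: sum_nonneg_eq_0_iff)
    then show False using H_eqI[OF dual_elt_in_H] dual_elt_nonzero[OF \<nu>] by blast
  qed
  then have pos: "0 < (\<Sum>b\<in>B. (r b)\<^sup>2)" using sum_nonneg[of B "\<lambda>b. (r b)\<^sup>2"] by simp
  obtain s :: "('g \<Rightarrow> complex) \<Rightarrow> real"
    where s: "\<And>\<alpha>. \<alpha> \<in> \<Delta> \<Longrightarrow> s \<alpha> \<le> 0 \<and> (\<Sum>b\<in>negative_part. wt b (dual_elt \<alpha>)) = of_real (s \<alpha>)"
    using negative_trace_simple by metis
  have "(\<Sum>b\<in>negative_part. wt b (dual_elt \<nu>))
      = (\<Sum>b\<in>negative_part. \<Sum>\<alpha>\<in>\<Delta>. of_real (u \<alpha>) * wt b (dual_elt \<alpha>))"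
    using wt_\<nu> by (intro sum.cong) (auto simp: negative_part_def)
  also have "\<dots> = (\<Sum>\<alpha>\<in>\<Delta>. of_real (u \<alpha>) * (\<Sum>b\<in>negative_part. wt b (dual_elt \<alpha>)))"
    by (subst sum.swap) (simp add: sum_distrib_left)
  also have "\<dots> = of_real (\<Sum>\<alpha>\<in>\<Delta>. u \<alpha> * s \<alpha>)" using s by simp
  finally have trace: "(\<Sum>b\<in>negative_part. wt b (dual_elt \<nu>)) = of_real (\<Sum>\<alpha>\<in>\<Delta>. u \<alpha> * s \<alpha>)" .
  have "(\<Sum>\<alpha>\<in>\<Delta>. u \<alpha> * s \<alpha>) \<le> 0"
    using u(2) s by (intro sum_nonpos) (auto simp: mult_nonneg_nonpos)
  moreover have "casimir_scalar \<nu> = of_real ((\<Sum>b\<in>B. (r b)\<^sup>2) - (\<Sum>\<alpha>\<in>\<Delta>. u \<alpha> * s \<alpha>))"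
    unfolding casimir_scalar_def norm trace by simp
  ultimately show ?thesis using pos by (simp del: of_real_sum of_real_diff)
qed

end

section \<open>The Casimir operator\<close>

locale casimir_module =
  based_weight_basis scale bracket H B wt \<Delta> + full_module scale bracket scaleM act
  for scale :: "complex \<Rightarrow> 'g::ab_group_add \<Rightarrow> 'g" and bracket H B wt \<Delta>
    and scaleM :: "complex \<Rightarrow> 'm::ab_group_add \<Rightarrow> 'm" and act :: "'g \<Rightarrow> 'm \<Rightarrow> 'm"
begin

definition casimir :: "'m \<Rightarrow> 'm"
  where "casimir v = (\<Sum>b\<in>B. act (dual_vec b) (act b v))"

lemma casimir_linear:
  "casimir (v + w) = casimir v + casimir w" "casimir (scaleM c v) = scaleM c (casimir v)"
  by (simp_all add: casimir_def act_linear sum.distrib M.scale_sum_right)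

text \<open>The commutators of \<open>x\<close> with the two factors cancel since the Killing form is invariant.\<close>

lemma casimir_act: "act x (casimir v) = casimir (act x v)"
proof -
  have 1: "(\<Sum>b\<in>B. act (bracket x (dual_vec b)) (act b v))
      = (\<Sum>b\<in>B. \<Sum>c\<in>B. scaleM (killing (bracket x (dual_vec b)) c) (act (dual_vec c) (act b v)))"
    by (subst (1) expansion_dual_vec[symmetric]) (simp add: act_sum_left act_linear)
  have "(\<Sum>b\<in>B. act (dual_vec b) (act (bracket x b) v))
      = (\<Sum>b\<in>B. \<Sum>c\<in>B. scaleM (killing (bracket x b) (dual_vec c)) (act (dual_vec b) (act c v)))"
    by (subst (1) expansion_B[symmetric]) (simp add: act_sum_left act_sum_right act_linear)
  also have "\<dots>
      = (\<Sum>b\<in>B. \<Sum>c\<in>B. scaleM (killing (bracket x c) (dual_vec b)) (act (dual_vec c) (act b v)))"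
    by (rule sum.swap)
  finally have 2: "(\<Sum>b\<in>B. act (dual_vec b) (act (bracket x b) v))
      = (\<Sum>b\<in>B. \<Sum>c\<in>B. scaleM (killing (bracket x c) (dual_vec b)) (act (dual_vec c) (act b v)))" .
  have 3: "killing (bracket x (dual_vec b)) c = - killing (bracket x c) (dual_vec b)" for b c
    using bracket_commute[of x "dual_vec b"] killing_sym[of "bracket x c"]
    by (simp add: killing_minus killing_invariant)
  have zero: "(\<Sum>b\<in>B. act (bracket x (dual_vec b)) (act b v))
      + (\<Sum>b\<in>B. act (dual_vec b) (act (bracket x b) v)) = 0"
    unfolding 1 2 3 by (simp add: sum_negf)
  have split: "act x (act (dual_vec b) (act b v)) = act (bracket x (dual_vec b)) (act b v)
      + act (dual_vec b) (act (bracket x b) v) + act (dual_vec b) (act b (act x v))" for b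
    by (simp add: act_commutator act_diff_right)
  have "act x (casimir v) = (\<Sum>b\<in>B. act (bracket x (dual_vec b)) (act b v))
      + (\<Sum>b\<in>B. act (dual_vec b) (act (bracket x b) v)) + casimir (act x v)"
    unfolding casimir_def act_sum_right split by (simp add: sum.distrib)
  then show ?thesis using zero by simp
qed

lemma casimir_weight_space:
  "v \<in> weight_space H scaleM act \<mu> \<Longrightarrow> casimir v \<in> weight_space H scaleM act \<mu>"
  by (simp add: weight_space_def casimir_act casimir_linear)

abbreviation positive_root_vectors :: "'g set"
  where "positive_root_vectors \<equiv> \<Union>\<alpha>\<in>positive_roots H \<Delta>. root_space H \<alpha>"

definition positive_part_basis :: "'g set"
  where "positive_part_basis = {b \<in> B. wt b \<in> positive_cone}"

lemma positive_basis_vector: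
  assumes "b \<in> positive_part_basis"
  shows "b \<in> positive_root_vectors"
proof -
  have b: "b \<in> B" "wt b \<in> positive_cone" using assms by (auto simp: positive_part_basis_def)
  then have "wt b \<in> roots H"
    using zero_notin_positive_cone
    by (intro nonzero_root_vector_root[OF wt_dual _ wt_root_space B_nonzero]) auto
  then have "wt b \<in> positive_roots H \<Delta>" using b by (simp add: positive_roots_eq)
  then show ?thesis using wt_root_space[OF b(1)] by blast
qed

lemma dual_vec_nonzero: "b \<in> B \<Longrightarrow> dual_vec b \<noteq> 0"
  using killing_dual_vec[of b b] by auto

lemma dual_negative_basis_vector:
  assumes "b \<in> negative_part"
  shows "dual_vec b \<in> positive_root_vectors"
proof -
  have b: "b \<in> B" "- wt b \<in> positive_cone" using assms by (auto simp: negative_part_def)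
  then have "- wt b \<in> roots H"
    using zero_notin_positive_cone
    by (intro nonzero_root_vector_root[OF dual_space_uminus[OF wt_dual] _ dual_vec_root_space
          dual_vec_nonzero]) auto
  then have "- wt b \<in> positive_roots H \<Delta>" using b by (simp add: positive_roots_eq)
  then show ?thesis using dual_vec_root_space[OF b(1)] by blast
qed

text \<open>For \<open>b\<close> in the negative part the product is reordered so that the factor of positive weight
  acts first.\<close>

lemma casimir_on_weight_space:
  assumes v: "v \<in> weight_space H scaleM act \<nu>" and \<nu>: "\<nu> \<in> dual_space H"
  shows "casimir v = scaleM (casimir_scalar \<nu>) v
    + (\<Sum>b\<in>positive_part_basis. act (dual_vec b) (act b v))
    + (\<Sum>b\<in>negative_part. act b (act (dual_vec b) v))"
proof -
  have act_H: "act h v = scaleM (\<nu> h) v" if "h \<in> H" for h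
    using v that by (auto simp: weight_space_def)
  let ?Z = "{b \<in> B. wt b = 0}" and ?t = "\<lambda>b. act (dual_vec b) (act b v)"
  have "\<nu> (dual_elt \<nu>) = (\<Sum>b\<in>?Z. \<nu> (scale (\<nu> b) (dual_vec b)))"
    unfolding dual_elt_def using dual_vec_in_H subspace_scale[OF subspace_H]
    by (intro dual_space_sum[OF \<nu>]) auto
  also have "\<dots> = (\<Sum>b\<in>?Z. \<nu> b * \<nu> (dual_vec b))"
    using dual_vec_in_H by (intro sum.cong) (auto simp: dual_space_D(2)[OF \<nu>])
  finally have "scaleM (\<nu> (dual_elt \<nu>)) v = (\<Sum>b\<in>?Z. scaleM (\<nu> b * \<nu> (dual_vec b)) v)"
    by (simp add: M.scale_sum_left)
  also have "\<dots> = sum ?t ?Z"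
    using act_H[OF wt_eq_zero] act_H[OF dual_vec_in_H] by (intro sum.cong) (auto simp: act_linear)
  finally have zero_part: "sum ?t ?Z = scaleM (\<nu> (dual_elt \<nu>)) v" ..
  have "?t b = act b (act (dual_vec b) v) - scaleM (wt b (dual_elt \<nu>)) v" if "b \<in> negative_part" for b
  proof -
    have b: "b \<in> B" using that by (simp add: negative_part_def)
    have "bracket (dual_vec b) b = dual_elt (- wt b)"
      using commutator_dual_elt[OF dual_space_uminus[OF wt_dual[OF b]] dual_vec_root_space[OF b], of b]
        wt_root_space[OF b] killing_dual_vec[OF b b] by simp
    moreover have "\<nu> (dual_elt (- wt b)) = - wt b (dual_elt \<nu>)"
      using dual_elt_sym[OF \<nu> dual_space_uminus[OF wt_dual[OF b]]] by simp
    ultimately show ?thesis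
      using act_commutator[of "dual_vec b" b v] act_H[OF dual_elt_in_H] by (simp add: algebra_simps)
  qed
  then have neg: "sum ?t negative_part = (\<Sum>b\<in>negative_part. act b (act (dual_vec b) v))
      - scaleM (\<Sum>b\<in>negative_part. wt b (dual_elt \<nu>)) v"
    by (simp add: sum_subtractf M.scale_sum_left)
  have split: "B = ?Z \<union> positive_part_basis \<union> negative_part"
    using wt_cases by (auto simp: positive_part_basis_def negative_part_def)
  have "casimir v = sum ?t (?Z \<union> positive_part_basis \<union> negative_part)"
    unfolding casimir_def using split by (rule arg_cong)
  also have "\<dots> = sum ?t (?Z \<union> positive_part_basis) + sum ?t negative_part"
    using finite_B zero_notin_positive_cone positive_cone_uminus
    by (intro sum.union_disjoint) (auto simp: positive_part_basis_def negative_part_def)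
  also have "sum ?t (?Z \<union> positive_part_basis) = sum ?t ?Z + sum ?t positive_part_basis"
    using finite_B zero_notin_positive_cone
    by (intro sum.union_disjoint) (auto simp: positive_part_basis_def)
  finally have "casimir v = sum ?t ?Z + sum ?t positive_part_basis + sum ?t negative_part" .
  then show ?thesis
    unfolding zero_part neg casimir_scalar_def by (simp add: M.scale_left_diff_distrib algebra_simps)
qed

text \<open>The polynomial in the Casimir operator whose roots are the entries of \<open>cs\<close>.\<close>

definition casimir_prod :: "complex list \<Rightarrow> 'm \<Rightarrow> 'm"
  where "casimir_prod cs v = foldr (\<lambda>c w. casimir w - scaleM c w) cs v"

lemma casimir_prod_simps:
  "casimir_prod [] v = v"
  "casimir_prod (c # cs) v = casimir (casimir_prod cs v) - scaleM c (casimir_prod cs v)"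
  "casimir_prod (cs @ ds) v = casimir_prod cs (casimir_prod ds v)"
  by (simp_all add: casimir_prod_def)

lemma casimir_diff: "casimir (v - w) = casimir v - casimir w"
  using casimir_linear(1)[of v "- w"] casimir_linear(2)[of "-1" w] by simp

lemma casimir_prod_linear:
  "casimir_prod cs (v + w) = casimir_prod cs v + casimir_prod cs w"
  "casimir_prod cs (scaleM c v) = scaleM c (casimir_prod cs v)"
  by (induction cs)
    (simp_all add: casimir_prod_simps casimir_linear M.scale_right_distrib
      M.scale_right_diff_distrib add_diff_add mult.commute)

lemma casimir_prod_diff: "casimir_prod cs (v - w) = casimir_prod cs v - casimir_prod cs w"
  using casimir_prod_linear(1)[of cs v "- w"] casimir_prod_linear(2)[of cs "-1" w] by simp

lemma casimir_prod_zero: "casimir_prod cs 0 = 0"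
  using casimir_prod_diff[of cs 0 0] by simp

lemma casimir_prod_sum: "casimir_prod cs (sum f A) = (\<Sum>a\<in>A. casimir_prod cs (f a))"
  by (induction A rule: infinite_finite_induct) (auto simp: casimir_prod_linear casimir_prod_zero)

lemma casimir_prod_act: "act x (casimir_prod cs v) = casimir_prod cs (act x v)"
  by (induction cs) (simp_all add: casimir_prod_simps act_diff_right casimir_act act_linear)

lemma casimir_prod_casimir: "casimir (casimir_prod cs v) = casimir_prod cs (casimir v)"
  by (induction cs) (simp_all add: casimir_prod_simps casimir_diff casimir_linear)

lemma casimir_prod_commute: "casimir_prod cs (casimir_prod ds v) = casimir_prod ds (casimir_prod cs v)"
  by (induction cs) (simp_all add: casimir_prod_simps casimir_prod_linear casimir_prod_diff casimir_prod_casimir)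

lemma casimir_prod_on_kernel:
  assumes "casimir w = 0"
  shows "casimir_prod cs w = scaleM (\<Prod>c\<leftarrow>cs. - c) w"
  by (induction cs) (simp_all add: casimir_prod_simps casimir_linear assms)

lemma common_casimir_prod:
  assumes "finite A" "\<And>a. a \<in> A \<Longrightarrow> \<exists>cs. 0 \<notin> set cs \<and> casimir_prod cs (g a) = 0"
  shows "\<exists>cs. 0 \<notin> set cs \<and> (\<forall>a\<in>A. casimir_prod cs (g a) = 0)"
  using assms
proof (induction A rule: finite_induct)
  case empty
  show ?case by (intro exI[of _ "[]"]) simp
next
  case (insert a A)
  obtain cs where cs: "0 \<notin> set cs" "\<forall>a\<in>A. casimir_prod cs (g a) = 0" using insert by auto
  obtain ds where ds: "0 \<notin> set ds" "casimir_prod ds (g a) = 0" using insert.prems[of a] by auto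
  have "casimir_prod (ds @ cs) (g b) = 0" if "b \<in> insert a A" for b
    using that cs(2) ds(2) casimir_prod_commute[of ds cs "g b"]
    by (auto simp: casimir_prod_simps casimir_prod_zero)
  then show ?case using cs(1) ds(1) by (intro exI[of _ "ds @ cs"]) auto
qed

text \<open>The difference is a sum of terms \<open>act x (act s v)\<close> with \<open>s\<close> a positive root vector, and polynomials
  in the Casimir operator commute with \<open>act x\<close> and with each other.\<close>

lemma casimir_prod_reduce:
  assumes v: "v \<in> weight_space H scaleM act \<nu>" and \<nu>: "\<nu> \<in> dual_space H"
    and raised: "\<And>s \<alpha>. \<alpha> \<in> positive_roots H \<Delta> \<Longrightarrow> s \<in> root_space H \<alpha> \<Longrightarrow>
      \<exists>cs. 0 \<notin> set cs \<and> casimir_prod cs (act s v) = 0"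
  shows "\<exists>cs. 0 \<notin> set cs \<and> casimir_prod cs (casimir v - scaleM (casimir_scalar \<nu>) v) = 0"
proof -
  have fin: "finite positive_part_basis" "finite negative_part"
    using finite_B by (auto simp: positive_part_basis_def negative_part_def)
  obtain cs where cs: "0 \<notin> set cs" "\<forall>b\<in>positive_part_basis. casimir_prod cs (act b v) = 0"
    using common_casimir_prod[OF fin(1), of "\<lambda>b. act b v"] positive_basis_vector raised by blast
  obtain ds where ds: "0 \<notin> set ds" "\<forall>b\<in>negative_part. casimir_prod ds (act (dual_vec b) v) = 0"
    using common_casimir_prod[OF fin(2), of "\<lambda>b. act (dual_vec b) v"] dual_negative_basis_vector
      raised by blast
  let ?p = "\<Sum>b\<in>positive_part_basis. act (dual_vec b) (act b v)"
  let ?n = "\<Sum>b\<in>negative_part. act b (act (dual_vec b) v)"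
  have "casimir_prod cs ?p = 0" "casimir_prod ds ?n = 0"
    using cs ds by (simp_all add: casimir_prod_sum flip: casimir_prod_act)
  then have "casimir_prod (cs @ ds) (?p + ?n) = 0"
    using casimir_prod_commute[of cs ds ?p]
    by (simp add: casimir_prod_simps casimir_prod_linear casimir_prod_zero)
  moreover have "casimir v - scaleM (casimir_scalar \<nu>) v = ?p + ?n"
    using casimir_on_weight_space[OF v \<nu>] by (simp add: algebra_simps)
  ultimately show ?thesis using cs(1) ds(1) by (intro exI[of _ "cs @ ds"]) auto
qed

text \<open>The Casimir operator differs from a nonzero scalar by terms that first apply a positive root
  vector. This lowers the level and keeps the weight positive.\<close>

lemma positive_weight_casimir_prod:
  assumes "v \<in> nil_level act positive_root_vectors k"
    and "v \<in> weight_space H scaleM act \<nu>" "\<nu> \<in> positive_cone"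
  shows "\<exists>cs. 0 \<notin> set cs \<and> casimir_prod cs v = 0"
  using assms
proof (induction k arbitrary: v \<nu>)
  case 0
  then show ?case by (intro exI[of _ "[]"]) (simp add: casimir_prod_simps)
next
  case (Suc k)
  have "\<exists>cs. 0 \<notin> set cs \<and> casimir_prod cs (casimir v - scaleM (casimir_scalar \<nu>) v) = 0"
  proof (rule casimir_prod_reduce[OF Suc.prems(2)])
    show "\<nu> \<in> dual_space H" using Suc.prems(3) positive_cone_dual_space by blast
    fix s \<alpha> assume \<alpha>: "\<alpha> \<in> positive_roots H \<Delta>" and s: "s \<in> root_space H \<alpha>"
    show "\<exists>cs. 0 \<notin> set cs \<and> casimir_prod cs (act s v) = 0"
    proof (rule Suc.IH)
      show "act s v \<in> nil_level act positive_root_vectors k" using Suc.prems(1) \<alpha> s by auto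
      show "act s v \<in> weight_space H scaleM act (\<alpha> + \<nu>)" using s Suc.prems(2) by (rule act_weight)
      show "\<alpha> + \<nu> \<in> positive_cone"
        using \<alpha> Suc.prems(3) by (auto simp: positive_roots_eq intro: positive_cone_add)
    qed
  qed
  then obtain cs where "0 \<notin> set cs" "casimir_prod (cs @ [casimir_scalar \<nu>]) v = 0"
    by (auto simp: casimir_prod_simps)
  then show ?case
    using casimir_scalar_nonzero[OF Suc.prems(3)]
    by (intro exI[of _ "cs @ [casimir_scalar \<nu>]"]) auto
qed

text \<open>For weight zero the scalar vanishes, so that a polynomial with nonzero roots maps \<open>v\<close> into the
  kernel of the Casimir operator. On this kernel every such polynomial is a nonzero scalar. A
  positive root vector \<open>s\<close> maps the image of \<open>v\<close> again into the kernel, but \<open>act s v\<close> has positive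
  weight and is killed by such a polynomial.\<close>

theorem casimir_projection:
  assumes v: "v \<in> nil_level act positive_root_vectors k" "v \<in> weight_space H scaleM act 0"
  shows "\<exists>cs. 0 \<notin> set cs \<and> (\<forall>s\<in>positive_root_vectors. act s (casimir_prod cs v) = 0)"
proof -
  have raised: "\<exists>cs. 0 \<notin> set cs \<and> casimir_prod cs (act s v) = 0"
    if "\<alpha> \<in> positive_roots H \<Delta>" "s \<in> root_space H \<alpha>" for \<alpha> s
  proof -
    have "v \<in> nil_level act positive_root_vectors (Suc k)"
      using v(1) nil_level_Suc_mono by blast
    then have "act s v \<in> nil_level act positive_root_vectors k" using that by auto
    moreover have "act s v \<in> weight_space H scaleM act \<alpha>" using act_weight[OF that(2) v(2)] by simp
    moreover have "\<alpha> \<in> positive_cone" using that(1) by (simp add: positive_roots_eq)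
    ultimately show ?thesis by (rule positive_weight_casimir_prod)
  qed
  have "dual_elt 0 = 0" by (simp add: dual_elt_def)
  moreover have "wt b 0 = 0" if "b \<in> B" for b
    using dual_space_D(2)[OF wt_dual[OF that], of 0 0] subspace_0[OF subspace_H] by simp
  ultimately have "casimir_scalar 0 = 0"
    by (simp add: casimir_scalar_def negative_part_def)
  moreover have "\<exists>cs. 0 \<notin> set cs \<and> casimir_prod cs (casimir v - scaleM (casimir_scalar 0) v) = 0"
    by (rule casimir_prod_reduce[OF v(2) dual_space_zero]) (rule raised)
  ultimately obtain cs where cs: "0 \<notin> set cs" "casimir_prod cs (casimir v) = 0" by auto
  have "act s (casimir_prod cs v) = 0" if s: "s \<in> positive_root_vectors" for s
  proof -
    obtain \<alpha> where "\<alpha> \<in> positive_roots H \<Delta>" "s \<in> root_space H \<alpha>" using s by blast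
    then obtain ds where ds: "0 \<notin> set ds" "casimir_prod ds (act s v) = 0"
      using raised by blast
    have "casimir (act s (casimir_prod cs v)) = 0"
      using cs(2) by (simp add: casimir_prod_casimir flip: casimir_act)
    then have "casimir_prod ds (act s (casimir_prod cs v))
        = scaleM (\<Prod>c\<leftarrow>ds. - c) (act s (casimir_prod cs v))"
      by (rule casimir_prod_on_kernel)
    moreover have "casimir_prod ds (act s (casimir_prod cs v)) = 0"
      using ds(2) casimir_prod_commute[of ds cs "act s v"]
      by (simp add: casimir_prod_act casimir_prod_zero)
    moreover have "(\<Prod>c\<leftarrow>ds. - c) \<noteq> 0" using ds(1) by (induction ds) auto
    ultimately show ?thesis by simp
  qed
  then show ?thesis using cs(1) by blast
qed

lemma casimir_prod_weight_space:
  "v \<in> weight_space H scaleM act \<mu> \<Longrightarrow> casimir_prod cs v \<in> weight_space H scaleM act \<mu>"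
  by (induction cs)
    (auto simp: casimir_prod_simps
      intro!: M.subspace_diff[OF subspace_weight_space] M.subspace_scale[OF subspace_weight_space]
        casimir_weight_space)

lemma casimir_prod_nil_level:
  "v \<in> nil_level act S k \<Longrightarrow> casimir_prod cs v \<in> nil_level act S k"
  by (induction k arbitrary: v) (auto simp: casimir_prod_zero casimir_prod_act)

text \<open>This is a computation in \<open>sl\<^sub>2\<close>. With \<open>c = \<gamma> (dual_elt \<gamma>)\<close>, the opposite root vector \<open>e\<close> maps
  the \<open>(j + 1)\<close>st power of \<open>y\<close> on \<open>w\<close> to \<open>- c * j * (j + 1) / 2\<close> times the \<open>j\<close>th. For \<open>j > 0\<close>
  this factor is nonzero, so that the last nonzero power is that for \<open>j = 0\<close>.\<close>

lemma opposite_vector_annihilates: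
  assumes w: "w \<in> weight_space H scaleM act 0"
    and \<gamma>: "\<gamma> \<in> roots H" "y \<in> root_space H \<gamma>"
    and e: "\<And>e. e \<in> root_space H (- \<gamma>) \<Longrightarrow> act e w = 0"
    and nil: "w \<in> nil_level act {y} k"
  shows "act y w = 0"
proof (cases "y = 0")
  case False
  obtain e where e': "e \<in> root_space H (- \<gamma>)" and h: "bracket y e = dual_elt \<gamma>"
    using opposite_root_vector[OF roots_D(1)[OF \<gamma>(1)] \<gamma>(2) False] by blast
  let ?c = "\<gamma> (dual_elt \<gamma>)" and ?u = "\<lambda>j. (act y ^^ j) w"
  have c: "?c \<noteq> 0" using root_pairings_real(1)[OF \<gamma>(1)] by auto
  have wt: "act (dual_elt \<gamma>) (?u j) = scaleM (of_nat j * ?c) (?u j)" for j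
  proof -
    have "?u j \<in> weight_space H scaleM act (\<lambda>x. of_nat j * \<gamma> x)"
    proof (induction j)
      case 0
      then show ?case using w by (simp add: zero_fun_def)
    next
      case (Suc j)
      have "\<gamma> + (\<lambda>x. of_nat j * \<gamma> x) = (\<lambda>x. of_nat (Suc j) * \<gamma> x)"
        by (auto simp: fun_eq_iff algebra_simps)
      then show ?case using act_weight[OF \<gamma>(2) Suc] by simp
    qed
    then show ?thesis using dual_elt_in_H by (auto simp: weight_space_def)
  qed
  have e_u: "act e (?u (Suc j)) = scaleM (- ?c * of_nat (\<Sum>i\<le>j. i)) (?u j)" for j
  proof (induction j)
    case 0
    have "act e (act y w) = act y (act e w) - act (bracket y e) w" by (simp add: act_commutator)
    then show ?case using e[OF e'] h wt[of 0] by simp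
  next
    case (Suc j)
    have "act e (?u (Suc (Suc j))) = act y (act e (?u (Suc j))) - act (bracket y e) (?u (Suc j))"
      by (simp add: act_commutator)
    also have "\<dots> = scaleM (- ?c * of_nat (\<Sum>i\<le>j. i)) (?u (Suc j))
        - scaleM (of_nat (Suc j) * ?c) (?u (Suc j))"
      unfolding Suc h wt by (simp add: act_linear act_minus_right)
    also have "\<dots> = scaleM (- ?c * of_nat (\<Sum>i\<le>Suc j. i)) (?u (Suc j))"
    proof -
      have "- ?c * of_nat (\<Sum>i\<le>j. i) - of_nat (Suc j) * ?c = - ?c * of_nat (\<Sum>i\<le>Suc j. i)"
        by (simp add: algebra_simps)
      then show ?thesis by (simp only: M.scale_left_diff_distrib[symmetric])
    qed
    finally show ?case .
  qed
  have "?u k = 0"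
    using nil by (induction k arbitrary: w) (auto simp: funpow_Suc_right simp del: funpow.simps)
  then obtain n where n: "?u n = 0" "\<And>m. m < n \<Longrightarrow> ?u m \<noteq> 0"
    using exists_least_iff[of "\<lambda>n. ?u n = 0"] by blast
  show ?thesis
  proof (cases "n \<le> 1")
    case True
    then have "n = 0 \<or> n = 1" by auto
    then show ?thesis using n(1) by auto
  next
    case False
    then obtain j where j: "n = Suc j" "0 < j" by (cases n) auto
    have "act e (?u (Suc j)) = 0" using n(1) j(1) by simp
    then have "- ?c * of_nat (\<Sum>i\<le>j. i) = 0" using e_u[of j] n(2)[of j] j(1) by simp
    then have "(\<Sum>i\<le>j. i) = (0::nat)" using c by (simp del: of_nat_sum)
    then have "j = 0" by simp
    then show ?thesis using j(2) by simp
  qed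
qed simp

end

section \<open>The module of linear maps\<close>

context lie_algebra
begin

lemma standard_parabolic_generators:
  shows "H \<subseteq> standard_parabolic H \<Delta> I"
    and "\<alpha> \<in> levi_roots H I \<Longrightarrow> root_space H \<alpha> \<subseteq> standard_parabolic H \<Delta> I"
    and "\<alpha> \<in> positive_roots H \<Delta> \<Longrightarrow> root_space H \<alpha> \<subseteq> standard_parabolic H \<Delta> I"
proof -
  have levi: "levi_subalgebra H I \<subseteq> standard_parabolic H \<Delta> I"
    unfolding standard_parabolic_def parabolic_nilradical_def using span_zero by force
  have "0 \<in> levi_subalgebra H I" by (simp add: levi_subalgebra_def span_zero)
  then have nil: "parabolic_nilradical H \<Delta> I \<subseteq> standard_parabolic H \<Delta> I"
    unfolding standard_parabolic_def by force
  show "H \<subseteq> standard_parabolic H \<Delta> I"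
    using levi span_superset unfolding levi_subalgebra_def by blast
  show l: "root_space H \<alpha> \<subseteq> standard_parabolic H \<Delta> I" if "\<alpha> \<in> levi_roots H I"
  proof -
    have "root_space H \<alpha> \<subseteq> levi_subalgebra H I"
      using that span_superset[of "H \<union> (\<Union>\<alpha>\<in>levi_roots H I. root_space H \<alpha>)"]
      unfolding levi_subalgebra_def by blast
    then show ?thesis using levi by blast
  qed
  show "root_space H \<alpha> \<subseteq> standard_parabolic H \<Delta> I" if "\<alpha> \<in> positive_roots H \<Delta>"
  proof (cases "\<alpha> \<in> levi_roots H I")
    case False
    then have "root_space H \<alpha> \<subseteq> parabolic_nilradical H \<Delta> I"
      using that span_superset[of "\<Union>\<alpha>\<in>positive_roots H \<Delta> - levi_roots H I. root_space H \<alpha>"]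
      unfolding parabolic_nilradical_def by blast
    then show ?thesis using nil by blast
  qed (rule l)
qed

lemma standard_parabolic_least:
  assumes "subspace K" "H \<subseteq> K"
    and "\<And>\<alpha>. \<alpha> \<in> levi_roots H I \<Longrightarrow> root_space H \<alpha> \<subseteq> K"
    and "\<And>\<alpha>. \<alpha> \<in> positive_roots H \<Delta> \<Longrightarrow> root_space H \<alpha> \<subseteq> K"
  shows "standard_parabolic H \<Delta> I \<subseteq> K"
proof -
  have "levi_subalgebra H I \<subseteq> K"
    unfolding levi_subalgebra_def using assms by (intro span_minimal) auto
  moreover have "parabolic_nilradical H \<Delta> I \<subseteq> K"
    unfolding parabolic_nilradical_def using assms by (intro span_minimal) auto
  ultimately show ?thesis
    unfolding standard_parabolic_def using subspace_add[OF assms(1)] by blast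
qed

end

locale hom_module =
  lie_algebra scale bracket +
  V: full_module scale bracket scaleV actV +
  M: full_module scale bracket scaleM actM
  for scale :: "complex \<Rightarrow> 'g::ab_group_add \<Rightarrow> 'g" and bracket
    and scaleV :: "complex \<Rightarrow> 'v::ab_group_add \<Rightarrow> 'v" and actV
    and scaleM :: "complex \<Rightarrow> 'm::ab_group_add \<Rightarrow> 'm" and actM +
  fixes C :: "'v set"
  assumes finite_C: "finite C" and independent_C: "V.M.independent C" and span_C: "V.M.span C = UNIV"
begin

definition extension :: "('v \<Rightarrow> 'm) \<Rightarrow> 'v \<Rightarrow> 'm"
  where "extension \<phi> v = (\<Sum>c\<in>C. scaleM (V.M.representation C v c) (\<phi> c))"

definition hom_scale :: "complex \<Rightarrow> ('v \<Rightarrow> 'm) \<Rightarrow> 'v \<Rightarrow> 'm"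
  where "hom_scale a \<phi> = (\<lambda>v. scaleM a (\<phi> v))"

lemma hom_scale_apply: "hom_scale a \<phi> v = scaleM a (\<phi> v)"
  by (simp add: hom_scale_def)

text \<open>On linear maps this is the action on \<open>Hom(V, M)\<close>. Since \<open>V\<close> is finite-dimensional with basis
  \<open>C\<close>, the use of the linear extension from \<open>C\<close> in the second term makes a module of all functions
  on \<open>V\<close>, in which the linear maps form a submodule.\<close>

definition hom_act :: "'g \<Rightarrow> ('v \<Rightarrow> 'm) \<Rightarrow> 'v \<Rightarrow> 'm"
  where "hom_act x \<phi> = (\<lambda>v. actM x (\<phi> v) - extension \<phi> (actV x v))"

lemma representation_C_linear:
  "V.M.representation C (v + w) c = V.M.representation C v c + V.M.representation C w c"
  "V.M.representation C (scaleV a v) c = a * V.M.representation C v c"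
  using V.M.representation_add[OF independent_C] V.M.representation_scale[OF independent_C] span_C
  by auto

lemma extension_linear:
  "extension \<phi> (v + w) = extension \<phi> v + extension \<phi> w"
  "extension \<phi> (scaleV a v) = scaleM a (extension \<phi> v)"
  by (simp_all add: extension_def representation_C_linear M.M.scale_left_distrib sum.distrib
      M.M.scale_sum_right)

lemma extension_basis: "c \<in> C \<Longrightarrow> extension \<phi> c = \<phi> c"
  using finite_C
  by (simp add: extension_def V.M.representation_basis[OF independent_C] sum.remove[of C c])

lemma linear_eq_on_basis:
  assumes "\<And>v w. f (v + w) = f v + f w" "\<And>a v. f (scaleV a v) = scaleN a (f v)"
    and "\<And>v w. g (v + w) = g v + g w" "\<And>a v. g (scaleV a v) = scaleN a (g v)"
    and "\<And>c. c \<in> C \<Longrightarrow> f c = g c" and "vector_space scaleN"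
  shows "f v = g v"
proof -
  interpret N: vector_space scaleN by fact
  have zero: "f 0 = 0" "g 0 = 0" using assms(2)[of 0 0] assms(4)[of 0 0] by simp_all
  have "v \<in> V.M.span C" using span_C by simp
  then show ?thesis
    by (induction rule: V.M.span_induct_alt) (simp_all add: zero assms(1-5))
qed

lemma vector_space_M: "vector_space scaleM"
  by unfold_locales

lemma extension_of_linear:
  assumes "\<And>v w. \<phi> (v + w) = \<phi> v + \<phi> w" "\<And>a v. \<phi> (scaleV a v) = scaleM a (\<phi> v)"
  shows "extension \<phi> v = \<phi> v"
  by (rule linear_eq_on_basis[of _ scaleM])
    (simp_all add: extension_linear assms extension_basis vector_space_M)

lemma extension_add: "extension (\<phi> + \<psi>) v = extension \<phi> v + extension \<psi> v"
  and extension_diff: "extension (\<lambda>v. \<phi> v - \<psi> v) v = extension \<phi> v - extension \<psi> v"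
  and extension_scale: "extension (\<lambda>v. scaleM a (\<phi> v)) v = scaleM a (extension \<phi> v)"
  by (simp_all add: extension_def M.M.scale_right_distrib M.M.scale_right_diff_distrib sum.distrib
      sum_subtractf M.M.scale_sum_right mult.commute)

lemma extension_act: "extension (\<lambda>v. actM x (\<phi> v)) v = actM x (extension \<phi> v)"
  by (simp add: extension_def M.act_sum_right M.act_linear)

lemma extension_comp: "extension (\<lambda>v. extension \<phi> (actV x v)) v = extension \<phi> (actV x v)"
  by (rule extension_of_linear) (simp_all add: V.act_linear extension_linear)

lemma full_module_hom: "full_module scale bracket hom_scale hom_act"
proof unfold_locales
  fix x y :: 'g and \<phi> :: "'v \<Rightarrow> 'm"
  have ext_diff: "extension \<phi> (v - w) = extension \<phi> v - extension \<phi> w" for v w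
    using extension_linear(1)[of \<phi> "v - w" w] by simp
  have comp: "hom_act x (hom_act y \<phi>) v = actM x (actM y (\<phi> v)) - actM x (extension \<phi> (actV y v))
      - actM y (extension \<phi> (actV x v)) + extension \<phi> (actV y (actV x v))" for x y v
    by (simp add: hom_act_def M.act_diff_right extension_diff extension_act extension_comp)
  show "hom_act (bracket x y) \<phi> = hom_act x (hom_act y \<phi>) - hom_act y (hom_act x \<phi>)"
    by (rule ext)
      (simp only: comp minus_apply, simp add: hom_act_def M.act_commutator V.act_commutator ext_diff)
qed (auto simp: fun_eq_iff hom_scale_def hom_act_def M.act_linear V.act_linear extension_linear
    extension_add extension_scale M.M.scale_right_distrib
    M.M.scale_left_distrib M.M.scale_right_diff_distrib subalgebra_def)

lemma hom_act_linear_map: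
  assumes "\<And>v w. \<phi> (v + w) = \<phi> v + \<phi> w" "\<And>a v. \<phi> (scaleV a v) = scaleM a (\<phi> v)"
  shows "hom_act x \<phi> v = actM x (\<phi> v) - \<phi> (actV x v)"
    and "hom_act x \<phi> (v + w) = hom_act x \<phi> v + hom_act x \<phi> w"
    and "hom_act x \<phi> (scaleV a v) = scaleM a (hom_act x \<phi> v)"
  by (simp_all add: hom_act_def extension_of_linear[OF assms] assms M.act_linear V.act_linear
      M.M.scale_right_diff_distrib)

text \<open>A factor that acts on \<open>\<phi>\<close> is applied either after the map or before it. In the first case it
  lowers the level in \<open>M\<close>, in the second case the level in \<open>V\<close>. The truncated subtraction makes
  \<open>\<phi>\<close> vanish on the level \<open>j\<close> when \<open>a + j \<le> b\<close>, because the level zero is the zero space.\<close>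

lemma hom_nil_level_shift:
  assumes "nil_level actV S b = UNIV"
    and "\<And>v w. \<phi> (v + w) = \<phi> v + \<phi> w" "\<And>c v. \<phi> (scaleV c v) = scaleM c (\<phi> v)"
    and "\<And>j v. j \<le> b \<Longrightarrow> v \<in> nil_level actV S j \<Longrightarrow> \<phi> v \<in> nil_level actM S (a + j - b)"
  shows "\<phi> \<in> nil_level hom_act S a"
  using assms(2-)
proof (induction a arbitrary: \<phi>)
  case 0
  then have "\<phi> v = 0" for v using 0(3)[of b v] assms(1) by simp
  then show ?case by (simp add: fun_eq_iff)
next
  case (Suc a)
  have "hom_act s \<phi> \<in> nil_level hom_act S a" if s: "s \<in> S" for s
  proof (rule Suc.IH)
    fix j v assume j: "j \<le> b" and v: "v \<in> nil_level actV S j"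
    have "actM s (\<phi> v) \<in> nil_level actM S (a + j - b)"
    proof (cases "b \<le> a + j")
      case True
      then show ?thesis using Suc.prems(3)[OF j v] s by (simp add: Suc_diff_le)
    next
      case False
      then have "\<phi> v = 0" using Suc.prems(3)[OF j v] by simp
      then show ?thesis by simp
    qed
    moreover have "\<phi> (actV s v) \<in> nil_level actM S (a + j - b)"
    proof (cases j)
      case 0
      then have "actV s v = 0" using v by simp
      then show ?thesis using Suc.prems(2)[of 0 0] by simp
    next
      case (Suc i)
      then have "actV s v \<in> nil_level actV S i" using v s by simp
      then show ?thesis using Suc.prems(3)[of i "actV s v"] j Suc by simp
    qed
    ultimately show "hom_act s \<phi> v \<in> nil_level actM S (a + j - b)"
      unfolding hom_act_linear_map(1)[OF Suc.prems(1,2)]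
      by (rule M.M.subspace_diff[OF M.nil_level_subspace])
  qed (use hom_act_linear_map[OF Suc.prems(1,2)] in auto)
  then show ?case by simp
qed

lemma hom_nilpotent:
  assumes "\<And>v. \<exists>k. v \<in> nil_level actV S k" "\<And>m. \<exists>k. m \<in> nil_level actM S k"
    and lin: "\<And>v w. \<phi> (v + w) = \<phi> v + \<phi> w" "\<And>c v. \<phi> (scaleV c v) = scaleM c (\<phi> v)"
  shows "\<exists>k. \<phi> \<in> nil_level hom_act S k"
proof -
  have "finite_dim scaleV UNIV" using finite_C span_C by (auto simp: finite_dim_def)
  then obtain b where b: "nil_level actV S b = UNIV" using V.nilpotent_uniform assms(1) by blast
  have "\<forall>c. \<exists>k. \<phi> c \<in> nil_level actM S k" using assms(2) by blast
  then obtain k where k: "\<And>c. \<phi> c \<in> nil_level actM S (k c)" by metis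
  define a where "a = Max (k ` C)"
  have base: "\<phi> c \<in> nil_level actM S a" if "c \<in> C" for c
    using k[of c] M.nil_level_mono[of "k c" a S] that finite_C by (auto simp: a_def)
  have "\<phi> v \<in> nil_level actM S a" for v
  proof -
    have "extension \<phi> v \<in> nil_level actM S a"
      unfolding extension_def
      using base by (intro M.M.subspace_sum M.M.subspace_scale M.nil_level_subspace)
    then show ?thesis by (simp add: extension_of_linear[OF lin])
  qed
  then have "\<phi> v \<in> nil_level actM S (a + b + j - b)" for v j
    using M.nil_level_mono[of a "a + b + j - b" S] by auto
  then have "\<phi> \<in> nil_level hom_act S (a + b)"
    by (intro hom_nil_level_shift[OF b lin])
  then show ?thesis by blast
qed

end

section \<open>Splitting a finite-dimensional quotient\<close>

lemma lie_hom_weight_space: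
  assumes "lie_hom UNIV scaleM actM scaleV actV f" "v \<in> weight_space H scaleM actM \<mu>"
  shows "f v \<in> weight_space H scaleV actV \<mu>"
proof -
  interpret f: Vector_Spaces.linear scaleM scaleV f using assms(1) by (simp add: lie_hom_def)
  have "actV x (f v) = scaleV (\<mu> x) (f v)" if "x \<in> H" for x
  proof -
    have "actV x (f v) = f (actM x v)" using assms(1) by (simp add: lie_hom_def)
    also have "\<dots> = scaleV (\<mu> x) (f v)"
      using assms(2) that by (simp add: weight_space_def f.scale)
    finally show ?thesis .
  qed
  then show ?thesis by (simp add: weight_space_def)
qed

lemma (in full_module) weight_module_quotient:
  assumes "weight_module H scaleM act" "full_module scale bracket scaleV actV"
    and f: "lie_hom UNIV scaleM act scaleV actV f" "surj f"
  shows "weight_module H scaleV actV"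
proof -
  interpret V: full_module scale bracket scaleV actV by fact
  interpret f: Vector_Spaces.linear scaleM scaleV f using f(1) by (simp add: lie_hom_def)
  have "f ` weight_space H scaleM act \<mu> \<subseteq> weight_space H scaleV actV \<mu>" for \<mu>
    using lie_hom_weight_space[OF f(1)] by blast
  then have "f ` (\<Union>\<mu>\<in>dual_space H. weight_space H scaleM act \<mu>)
      \<subseteq> (\<Union>\<mu>\<in>dual_space H. weight_space H scaleV actV \<mu>)" by blast
  then have "V.M.span (f ` (\<Union>\<mu>\<in>dual_space H. weight_space H scaleM act \<mu>))
      \<subseteq> V.M.span (\<Union>\<mu>\<in>dual_space H. weight_space H scaleV actV \<mu>)"
    by (rule V.M.span_mono)
  then show ?thesis
    using assms(1) f(2) unfolding weight_module_def f.span_image by auto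
qed

text \<open>Of the weight components of any preimage, the one of weight \<open>\<mu>\<close> is again a preimage.\<close>

lemma (in full_module) weight_vector_lift:
  assumes "weight_module H scaleM act" "full_module scale bracket scaleV actV"
    and f: "lie_hom UNIV scaleM act scaleV actV f" "surj f"
    and c: "c \<in> weight_space H scaleV actV \<mu>" "\<mu> \<in> dual_space H"
  shows "\<exists>m\<in>weight_space H scaleM act \<mu>. f m = c"
proof -
  interpret V: full_module scale bracket scaleV actV by fact
  interpret f: Vector_Spaces.linear scaleM scaleV f using f(1) by (simp add: lie_hom_def)
  obtain m where m: "f m = c" using f(2) by (metis surjD)
  have "m \<in> M.span (\<Union>\<mu>\<in>dual_space H. weight_space H scaleM act \<mu>)"
    using assms(1) by (simp add: weight_module_def)
  then obtain F w where F: "finite F" "F \<subseteq> dual_space H"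
    and w: "\<forall>\<nu>\<in>F. w \<nu> \<in> weight_space H scaleM act \<nu>" "m = (\<Sum>\<nu>\<in>F. w \<nu>)"
    using M.span_Union_subspaces_sum[of "dual_space H" "weight_space H scaleM act" m]
      subspace_weight_space by blast
  define w' where "w' \<nu> = (if \<nu> \<in> F then w \<nu> else 0)" for \<nu>
  have w': "w' \<nu> \<in> weight_space H scaleM act \<nu>" for \<nu>
    using w(1) M.subspace_0[OF subspace_weight_space] by (auto simp: w'_def)
  define u where "u \<nu> = f (w' \<nu>) - (if \<nu> = \<mu> then c else 0)" for \<nu>
  have "(\<Sum>\<nu>\<in>insert \<mu> F. u \<nu>) = f (\<Sum>\<nu>\<in>insert \<mu> F. w' \<nu>) - c"
    using F(1) by (simp add: u_def sum_subtractf f.sum del: sum.insert)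
  also have "(\<Sum>\<nu>\<in>insert \<mu> F. w' \<nu>) = m"
    unfolding w(2) using F(1) by (intro sum.mono_neutral_cong_right) (auto simp: w'_def)
  finally have "(\<Sum>\<nu>\<in>insert \<mu> F. u \<nu>) = 0" using m by simp
  moreover have "u \<nu> \<in> weight_space H scaleV actV \<nu>" for \<nu>
  proof -
    have "f (w' \<nu>) \<in> weight_space H scaleV actV \<nu>"
      using w'[of \<nu>] by (rule lie_hom_weight_space[OF f(1)])
    then show ?thesis
      using c(1) V.M.subspace_0[OF V.subspace_weight_space]
      by (auto simp: u_def intro!: V.M.subspace_diff[OF V.subspace_weight_space])
  qed
  ultimately have "u \<mu> = 0"
    using V.weight_vectors_independent[of "insert \<mu> F" H u \<mu>] F c(2) by auto
  then show ?thesis using w'[of \<mu>] by (auto simp: u_def)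
qed

context hom_module
begin

text \<open>Composition with \<open>f\<close> is a homomorphism from \<open>Hom(V, M)\<close> to \<open>Hom(V, V)\<close>, where the scalar maps
  are invariant.\<close>

lemma hom_act_scalar_composition:
  assumes f: "lie_hom UNIV scaleM actM scaleV actV f"
    and \<phi>: "\<And>c. c \<in> C \<Longrightarrow> f (\<phi> c) = scaleV a c" and c: "c \<in> C"
  shows "f (hom_act x \<phi> c) = 0"
proof -
  interpret f: Vector_Spaces.linear scaleM scaleV f using f by (simp add: lie_hom_def)
  have "f (extension \<phi> v) = scaleV a v" for v
    by (rule linear_eq_on_basis[of _ scaleV])
      (simp_all add: extension_linear f.add f.scale extension_basis \<phi> V.M.scale_right_distrib
        mult.commute V.M.vector_space_axioms)
  then show ?thesis
    using f \<phi>[OF c] by (simp add: hom_act_def f.diff V.act_linear lie_hom_def)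
qed

text \<open>Lift each vector of a basis of weight vectors to a vector of the same weight, and extend
  linearly.\<close>

lemma weight_equivariant_section:
  assumes f: "lie_hom UNIV scaleM actM scaleV actV f" "surj f"
    and M: "weight_module H scaleM actM"
    and C: "\<And>c. c \<in> C \<Longrightarrow> \<exists>\<mu>\<in>dual_space H. c \<in> weight_space H scaleV actV \<mu>"
  shows "\<exists>\<phi>. (\<forall>v w. \<phi> (v + w) = \<phi> v + \<phi> w) \<and> (\<forall>a v. \<phi> (scaleV a v) = scaleM a (\<phi> v)) \<and>
    (\<forall>v. f (\<phi> v) = v) \<and> \<phi> \<in> weight_space H hom_scale hom_act 0"
proof -
  interpret f: Vector_Spaces.linear scaleM scaleV f using f by (simp add: lie_hom_def)
  have "\<exists>m. f m = c \<and> (\<exists>\<mu>. c \<in> weight_space H scaleV actV \<mu> \<and> m \<in> weight_space H scaleM actM \<mu>)"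
    if "c \<in> C" for c
    using C[OF that] M.weight_vector_lift[OF M V.full_module_axioms f] by blast
  then obtain m where m: "\<And>c. c \<in> C \<Longrightarrow> f (m c) = c"
    and wt: "\<And>c. c \<in> C \<Longrightarrow>
      \<exists>\<mu>. c \<in> weight_space H scaleV actV \<mu> \<and> m c \<in> weight_space H scaleM actM \<mu>"
    by metis
  let ?\<phi> = "extension m"
  have "f (?\<phi> v) = v" for v
    by (rule linear_eq_on_basis[of _ scaleV])
      (simp_all add: extension_linear f.add f.scale extension_basis m V.M.vector_space_axioms)
  moreover have "hom_act h ?\<phi> = 0" if h: "h \<in> H" for h
  proof (rule ext)
    fix v
    have "actM h (?\<phi> v) = ?\<phi> (actV h v)"
    proof (rule linear_eq_on_basis[of "\<lambda>v. actM h (?\<phi> v)" scaleM "\<lambda>v. ?\<phi> (actV h v)"])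
      fix c assume c: "c \<in> C"
      obtain \<mu> where "c \<in> weight_space H scaleV actV \<mu>" "m c \<in> weight_space H scaleM actM \<mu>"
        using wt[OF c] by blast
      then show "actM h (?\<phi> c) = ?\<phi> (actV h c)"
        using h c by (simp add: weight_space_def extension_linear extension_basis)
    qed (simp_all add: extension_linear M.act_linear V.act_linear vector_space_M)
    then show "hom_act h ?\<phi> v = 0 v"
      by (simp add: hom_act_linear_map(1)[of ?\<phi>] extension_linear)
  qed
  then have "?\<phi> \<in> weight_space H hom_scale hom_act 0"
    by (simp add: weight_space_def hom_scale_def fun_eq_iff)
  ultimately show ?thesis using extension_linear by blast
qed

text \<open>The linear extension of \<open>\<phi>\<close> from the basis, divided by \<open>a\<close>, is an equivariant section of \<open>f\<close>,
  and its image is a complement of the kernel of \<open>f\<close>.\<close>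

lemma direct_summand_section:
  assumes f: "lie_hom UNIV scaleM actM scaleV actV f"
    and \<phi>: "\<And>c. c \<in> C \<Longrightarrow> f (\<phi> c) = scaleV a c" "a \<noteq> 0"
    and inv: "\<And>x. x \<in> L \<Longrightarrow> hom_act x \<phi> = 0"
  shows "lie_direct_summand L scaleV actV scaleM actM"
proof -
  interpret f: Vector_Spaces.linear scaleM scaleV f using f by (simp add: lie_hom_def)
  define \<sigma> where "\<sigma> v = scaleM (inverse a) (extension \<phi> v)" for v
  have lin: "\<sigma> (v + w) = \<sigma> v + \<sigma> w" "\<sigma> (scaleV c v) = scaleM c (\<sigma> v)" for v w c
    by (simp_all add: \<sigma>_def extension_linear M.M.scale_right_distrib mult.commute)
  then interpret \<sigma>: Vector_Spaces.linear scaleV scaleM \<sigma>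
    by unfold_locales auto
  have sec: "f (\<sigma> v) = v" for v
    by (rule linear_eq_on_basis[of _ scaleV])
      (simp_all add: lin f.add f.scale \<sigma>_def[of c for c] extension_basis extension_linear \<phi>
        V.M.vector_space_axioms V.M.scale_right_distrib M.M.scale_right_distrib mult.commute)
  have equiv: "\<sigma> (actV x v) = actM x (\<sigma> v)" if x: "x \<in> L" for x v
  proof (rule linear_eq_on_basis[of _ scaleM])
    fix c assume c: "c \<in> C"
    have "actM x (\<phi> c) = extension \<phi> (actV x c)"
      using fun_cong[OF inv[OF x], of c] by (simp add: hom_act_def)
    then show "\<sigma> (actV x c) = actM x (\<sigma> c)"
      using c by (simp add: \<sigma>_def M.act_linear extension_basis)
  qed (simp_all add: lin V.act_linear M.act_linear vector_space_M)
  have hom: "lie_hom L scaleV actV scaleM actM \<sigma>"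
    using equiv \<sigma>.linear_axioms by (simp add: lie_hom_def)
  let ?A = "range \<sigma>" and ?B = "{m. f m = 0}"
  have "lie_submodule L scaleM actM ?A"
    unfolding lie_submodule_def
    by (auto simp: \<sigma>.subspace_image simp flip: equiv)
  moreover have "lie_submodule L scaleM actM ?B"
    unfolding lie_submodule_def M.M.subspace_def
    using f by (auto simp: f.add f.scale lie_hom_def)
  moreover have "?A \<inter> ?B = {0}"
  proof
    show "?A \<inter> ?B \<subseteq> {0}" using sec by auto
    show "{0} \<subseteq> ?A \<inter> ?B" using \<sigma>.zero[symmetric] by (auto intro: range_eqI[of _ _ 0])
  qed
  moreover have "m \<in> {a + b |a b. a \<in> ?A \<and> b \<in> ?B}" for m
  proof -
    have "m = \<sigma> (f m) + (m - \<sigma> (f m))" "m - \<sigma> (f m) \<in> ?B"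
      by (simp_all add: f.diff sec)
    then show ?thesis by blast
  qed
  then have "{a + b |a b. a \<in> ?A \<and> b \<in> ?B} = UNIV" by blast
  moreover have "inj \<sigma>" using sec by (metis injI)
  then have "bij_betw \<sigma> UNIV ?A" by (simp add: bij_betw_def)
  ultimately show ?thesis unfolding lie_direct_summand_def using hom by blast
qed

end

theorem proposition6:
  fixes scale :: "complex \<Rightarrow> 'g::ab_group_add \<Rightarrow> 'g"
    and bracket :: "'g \<Rightarrow> 'g \<Rightarrow> 'g"
    and H :: "'g set"
    and \<Delta> I :: "('g \<Rightarrow> complex) set"
    and scaleM :: "complex \<Rightarrow> 'm::ab_group_add \<Rightarrow> 'm"
    and actM :: "'g \<Rightarrow> 'm \<Rightarrow> 'm"
    and scaleV :: "complex \<Rightarrow> 'v::ab_group_add \<Rightarrow> 'v"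
    and actV :: "'g \<Rightarrow> 'v \<Rightarrow> 'v"
  assumes "lie_algebra scale bracket"
    and "finite_dim scale UNIV"
    and "lie_algebra.semisimple scale bracket"
    and "lie_algebra.cartan_subalgebra scale bracket H"
    and "lie_algebra.root_base scale bracket H \<Delta>"
    and "I \<subseteq> \<Delta>"
    and "lie_algebra.parabolic_category_O scale bracket H \<Delta> I scaleM actM"
    and "lie_module scale bracket UNIV scaleV actV"
    and "finite_dim scaleV UNIV"
    and "lie_quotient UNIV scaleV actV scaleM actM"
  shows "lie_direct_summand (lie_algebra.standard_parabolic scale bracket H \<Delta> I)
    scaleV actV scaleM actM"
proof -
  interpret lie_algebra scale bracket by fact
  interpret V: full_module scale bracket scaleV actV
    unfolding full_module_def by fact
  have O: "category_O H \<Delta> scaleM actM"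
    and lf: "locally_finite (standard_parabolic H \<Delta> I) scaleM actM"
    using assms(7) by (auto simp: parabolic_category_O_def)
  interpret M: full_module scale bracket scaleM actM
    using O unfolding full_module_def category_O_def by blast
  have wtM: "weight_module H scaleM actM" using O by (simp add: category_O_def)
  obtain f where f: "lie_hom UNIV scaleM actM scaleV actV f" "surj f"
    using assms(10) by (auto simp: lie_quotient_def)
  interpret f: Vector_Spaces.linear scaleM scaleV f using f by (simp add: lie_hom_def)
  have wtV: "weight_module H scaleV actV"
    by (rule M.weight_module_quotient[OF wtM V.full_module_axioms f])
  interpret cartan_setting scale bracket H
    using assms(2-4) by unfold_locales
  obtain B wt where "finite B" "independent B" "span B = UNIV"
    "\<forall>b\<in>B. wt b \<in> dual_space H \<and> b \<in> root_space H (wt b)"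
    using weight_basis_exists by blast
  then interpret based_weight_basis scale bracket H B wt \<Delta>
    using assms(5) by unfold_locales auto

  let ?U = "\<Union>\<mu>\<in>dual_space H. weight_space H scaleV actV \<mu>"
  obtain C where C: "C \<subseteq> ?U" "V.M.independent C" "?U \<subseteq> V.M.span C"
    using V.M.maximal_independent_subset by blast
  have "V.M.span ?U \<subseteq> V.M.span C" using C(3) by (rule V.M.span_minimal) simp
  then have span_C: "V.M.span C = UNIV" using wtV by (auto simp: weight_module_def)
  obtain C0 where "finite C0" "V.M.span C0 = UNIV" using assms(9) by (auto simp: finite_dim_def)
  then have "finite C" using V.M.independent_span_bound[of C0 C] C(2) by auto
  then interpret hom_module scale bracket scaleV actV scaleM actM C
    using C(2) span_C by unfold_locales auto
  interpret hom: casimir_module scale bracket H B wt \<Delta> hom_scale hom_act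
    by (intro casimir_module.intro based_weight_basis_axioms full_module_hom)
  have C_weights: "\<exists>\<mu>\<in>dual_space H. c \<in> weight_space H scaleV actV \<mu>" if "c \<in> C" for c
    using C(1) that by blast
  \<comment> \<open>The weight zero section from which the correction starts.\<close>
  obtain \<phi> where lin: "\<And>v w. \<phi> (v + w) = \<phi> v + \<phi> w" "\<And>a v. \<phi> (scaleV a v) = scaleM a (\<phi> v)"
    and sec: "\<And>v. f (\<phi> v) = v" and wt0: "\<phi> \<in> weight_space H hom_scale hom_act 0"
    using weight_equivariant_section[OF f wtM C_weights] by blast

  let ?n = "hom.positive_root_vectors" and ?p = "standard_parabolic H \<Delta> I"
  have n_cone: "?n \<subseteq> (\<Union>\<alpha>\<in>positive_cone. root_space H \<alpha>)" by (auto simp: positive_roots_eq)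
  have n_p: "?n \<subseteq> ?p" using standard_parabolic_generators(3) by blast
  have "\<exists>k. v \<in> nil_level actV ?n k" for v
    by (rule V.weight_module_nilpotent[OF positive_cone_dual_space zero_notin_positive_cone
          positive_cone_add n_cone V.finite_dim_stable[OF assms(9)] wtV])
  moreover have "\<exists>k. m \<in> nil_level actM ?n k" for m
    by (rule M.weight_module_nilpotent[OF positive_cone_dual_space zero_notin_positive_cone
          positive_cone_add n_cone M.locally_finite_stable[OF lf n_p] wtM])
  ultimately obtain k where "\<phi> \<in> nil_level hom_act ?n k"
    using hom_nilpotent[OF _ _ lin, of ?n] by blast
  then have "\<exists>cs. 0 \<notin> set cs \<and> (\<forall>s\<in>?n. hom_act s (hom.casimir_prod cs \<phi>) = 0)"
    using wt0 by (rule hom.casimir_projection)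
  then obtain cs where cs: "0 \<notin> set cs"
    and n_inv: "\<forall>s\<in>?n. hom_act s (hom.casimir_prod cs \<phi>) = 0"
    by auto
  \<comment> \<open>The corrected section, up to the scalar that \<open>\<psi>_f\<close> determines.\<close>
  define \<psi> where "\<psi> = hom.casimir_prod cs \<phi>"
  have \<psi>_wt: "\<psi> \<in> weight_space H hom_scale hom_act 0"
    unfolding \<psi>_def by (rule hom.casimir_prod_weight_space[OF wt0])

  have sum_apply: "(\<Sum>b\<in>A. g b) v = (\<Sum>b\<in>A. g b v)" for A :: "'g set" and g :: "'g \<Rightarrow> 'v \<Rightarrow> 'm" and v
    by (induction A rule: infinite_finite_induct) auto
  have casimir_f: "f (hom.casimir \<chi> c) = 0"
    if "\<And>c. c \<in> C \<Longrightarrow> f (\<chi> c) = scaleV a c" "c \<in> C" for \<chi> a c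
  proof -
    have "f (hom_act x \<chi> c) = scaleV 0 c" if "c \<in> C" for x c
      using hom_act_scalar_composition[OF f(1) \<open>\<And>c. c \<in> C \<Longrightarrow> f (\<chi> c) = scaleV a c\<close> that] by simp
    then have "f (hom_act y (hom_act x \<chi>) c) = 0" for x y
      by (rule hom_act_scalar_composition[OF f(1) _ \<open>c \<in> C\<close>])
    then show ?thesis by (simp add: hom.casimir_def sum_apply f.sum)
  qed
  have \<psi>_f: "f (\<psi> c) = scaleV (\<Prod>a\<leftarrow>cs. - a) c" if "c \<in> C" for c
    unfolding \<psi>_def using that
  proof (induction cs arbitrary: c)
    case Nil
    then show ?case by (simp add: hom.casimir_prod_simps sec)
  next
    case (Cons a cs)
    let ?\<chi> = "hom.casimir_prod cs \<phi>"
    have "hom.casimir_prod (a # cs) \<phi> c = hom.casimir ?\<chi> c - scaleM a (?\<chi> c)"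
      by (simp only: hom.casimir_prod_simps(2) minus_apply hom_scale_apply)
    then show ?case
      using casimir_f[OF Cons.IH Cons.prems] Cons by (simp add: f.diff f.scale)
  qed
  have "(\<Prod>a\<leftarrow>cs. - a) \<noteq> 0" using cs by (induction cs) auto

  moreover have "?p \<subseteq> {x. hom_act x \<psi> = 0}"
  proof (rule standard_parabolic_least)
    show "subspace {x. hom_act x \<psi> = 0}"
      unfolding subspace_def by (simp add: hom.act_linear)
    show "H \<subseteq> {x. hom_act x \<psi> = 0}"
      using \<psi>_wt by (auto simp: weight_space_def)
    show pos: "root_space H \<alpha> \<subseteq> {x. hom_act x \<psi> = 0}" if "\<alpha> \<in> positive_roots H \<Delta>" for \<alpha>
      using that n_inv by (auto simp: \<psi>_def)
    fix \<gamma> assume \<gamma>: "\<gamma> \<in> levi_roots H I"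
    then have root: "\<gamma> \<in> roots H" by (simp add: levi_roots_def)
    show "root_space H \<gamma> \<subseteq> {x. hom_act x \<psi> = 0}"
    proof (cases "\<gamma> \<in> positive_cone")
      case True
      then show ?thesis using root pos by (simp add: positive_roots_eq)
    next
      case False
      then have neg: "- \<gamma> \<in> positive_cone" using roots_cone[OF root] by blast
      \<comment> \<open>Local finiteness makes \<open>y\<close> act nilpotently, and the opposite root vectors already annihilate
        \<open>\<psi>\<close>.\<close>
      have "hom_act y \<psi> = 0" if y: "y \<in> root_space H \<gamma>" for y
      proof -
        have "{y} \<subseteq> ?p" using standard_parabolic_generators(2)[OF \<gamma>] y by blast
        then have "\<exists>k. m \<in> nil_level actM {y} k" for m
          by (rule M.root_vector_nilpotent[OF roots_D[OF root] y M.locally_finite_stable[OF lf] wtM])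
        moreover have "\<exists>k. v \<in> nil_level actV {y} k" for v
          by (rule V.root_vector_nilpotent[OF roots_D[OF root] y V.finite_dim_stable[OF assms(9)] wtV])
        ultimately obtain k where "\<phi> \<in> nil_level hom_act {y} k"
          using hom_nilpotent[OF _ _ lin, of "{y}"] by blast
        then have "\<psi> \<in> nil_level hom_act {y} k"
          unfolding \<psi>_def by (rule hom.casimir_prod_nil_level)
        moreover have "hom_act e \<psi> = 0" if e: "e \<in> root_space H (- \<gamma>)" for e
        proof (cases "e = 0")
          case False
          then have "- \<gamma> \<in> roots H"
            using nonzero_root_vector_root[OF dual_space_uminus[OF roots_D(1)[OF root]] _ e]
              roots_D(2)[OF root] by simp
          then show ?thesis using pos[of "- \<gamma>"] neg e by (auto simp: positive_roots_eq)
        qed simp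
        ultimately show ?thesis
          using hom.opposite_vector_annihilates[OF \<psi>_wt root y] by blast
      qed
      then show ?thesis by blast
    qed
  qed
  ultimately show ?thesis
    by (intro direct_summand_section[OF f(1) \<psi>_f]) auto
qed

end
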